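(* Let $\mathcal{X}$ be a Hilbert module over a pro-$C^*$-algebra $\mathcal{A}$, and let $K\in Hom^*_{\mathcal{A}}(\mathcal{X})$ be uniformly bounded with $Ran(K)$ dense in $\mathcal{X}$. Let $\{\xi_i\}_{i\in I}$ be a $K$-frame for $\mathcal{X}$ and let $T\in Hom^*_{\mathcal{A}}(\mathcal{X})$ be uniformly bounded with closed range. If $\{T\xi_i\}_{i\in I}$ is a $K$-frame for $\mathcal{X}$, then $T$ is surjective.
   Context: A pro-$C^*$-algebra $\mathcal{A}$ is a complete Hausdorff topological $*$-algebra whose topology is given by its continuous $C^*$-seminorms $S(\mathcal{A})$. A Hilbert $\mathcal{A}$-module $\mathcal{X}$ is a left $\mathcal{A}$-module with an $\mathcal{A}$-valued inner product, complete for $\bar p_{\mathcal{X}}(\xi)=\sqrt{p(\langle\xi,\xi\rangle)}$. $Hom^*_{\mathcal{A}}(\mathcal{X})$ denotes adjointable bounded $\mathcal{A}$-module maps; $T$ is uniformly bounded if there is a single $C>0$ with $\bar p_{\mathcal{X}}(T\xi)\le C\bar p_{\mathcal{X}}(\xi)$ for all $p,\xi$. A sequence $\{\xi_i\}_{i\in I}$ ($I$ countable) is a $K$-frame for $\mathcal{X}$ if $\sum_i\langle\xi,\xi_i\rangle\langle\xi_i,\xi\rangle$ converges in $\mathcal{A}$ and there are $A,B>0$ with $A\langle K^*\xi,K^*\xi\rangle\le\sum_i\langle\xi,\xi_i\rangle\langle\xi_i,\xi\rangle\le B\langle\xi,\xi\rangle$ for all $\xi\in\mathcal{X}$. *)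

theory Defs
  imports "HOL-Analysis.Analysis"
begin

text \<open>A pro-C*-algebra is presented by its carrier type (a possibly non-unital ring),
  a complex scalar multiplication, an involution and the family of its continuous
  C*-seminorms.\<close>

record 'a procstar =
  smul :: "complex \<Rightarrow> 'a \<Rightarrow> 'a"
  star :: "'a \<Rightarrow> 'a"
  seminorms :: "('a \<Rightarrow> real) set"

definition cstar_seminorm :: "('a::ring) procstar \<Rightarrow> ('a \<Rightarrow> real) \<Rightarrow> bool" where
  "cstar_seminorm A p \<longleftrightarrow>
     (\<forall>x y. p (x + y) \<le> p x + p y) \<and>
     (\<forall>c x. p (smul A c x) = cmod c * p x) \<and>
     (\<forall>x y. p (x * y) \<le> p x * p y) \<and>
     (\<forall>x. p (star A x * x) = (p x)\<^sup>2)"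

text \<open>Completeness of a type with a group structure w.r.t. the uniformity induced by a
  family of seminorms, stated with Cauchy filters (equivalent to completeness for nets).\<close>

definition sn_cauchy :: "('x::ab_group_add \<Rightarrow> real) set \<Rightarrow> 'x filter \<Rightarrow> bool" where
  "sn_cauchy P F \<longleftrightarrow> (\<forall>p\<in>P. \<forall>e>0. eventually (\<lambda>(x, y). p (x - y) < e) (F \<times>\<^sub>F F))"

definition sn_tendsto :: "('x::ab_group_add \<Rightarrow> real) set \<Rightarrow> 'x filter \<Rightarrow> 'x \<Rightarrow> bool" where
  "sn_tendsto P F l \<longleftrightarrow> (\<forall>p\<in>P. \<forall>e>0. eventually (\<lambda>x. p (x - l) < e) F)"

definition sn_complete :: "('x::ab_group_add \<Rightarrow> real) set \<Rightarrow> bool" where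
  "sn_complete P \<longleftrightarrow> (\<forall>F. F \<noteq> bot \<and> sn_cauchy P F \<longrightarrow> (\<exists>l. sn_tendsto P F l))"

definition pro_cstar_algebra :: "('a::ring) procstar \<Rightarrow> bool" where
  "pro_cstar_algebra A \<longleftrightarrow>
     \<comment> \<open>complex algebra\<close>
     (\<forall>c x y. smul A c (x + y) = smul A c x + smul A c y) \<and>
     (\<forall>c d x. smul A (c + d) x = smul A c x + smul A d x) \<and>
     (\<forall>c d x. smul A (c * d) x = smul A c (smul A d x)) \<and>
     (\<forall>x. smul A 1 x = x) \<and>
     (\<forall>c x y. smul A c (x * y) = smul A c x * y \<and> smul A c (x * y) = x * smul A c y) \<and>
     \<comment> \<open>involution\<close>
     (\<forall>x. star A (star A x) = x) \<and>
     (\<forall>x y. star A (x + y) = star A x + star A y) \<and>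
     (\<forall>x y. star A (x * y) = star A y * star A x) \<and>
     (\<forall>c x. star A (smul A c x) = smul A (cnj c) (star A x)) \<and>
     \<comment> \<open>the family of continuous C*-seminorms\<close>
     seminorms A \<noteq> {} \<and>
     (\<forall>p\<in>seminorms A. cstar_seminorm A p) \<and>
     (\<forall>p\<in>seminorms A. \<forall>q\<in>seminorms A. \<exists>r\<in>seminorms A. \<forall>x. p x \<le> r x \<and> q x \<le> r x) \<and>
     (\<forall>p. cstar_seminorm A p \<and> (\<exists>q\<in>seminorms A. \<exists>C>0. \<forall>x. p x \<le> C * q x)
           \<longrightarrow> p \<in> seminorms A) \<and>
     \<comment> \<open>Hausdorff and complete\<close>
     (\<forall>x. (\<forall>p\<in>seminorms A. p x = 0) \<longrightarrow> x = 0) \<and>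
     sn_complete (seminorms A)"

definition positive :: "('a::ring) procstar \<Rightarrow> 'a \<Rightarrow> bool" where
  "positive A a \<longleftrightarrow> (\<exists>c. a = star A c * c)"

definition leA :: "('a::ring) procstar \<Rightarrow> 'a \<Rightarrow> 'a \<Rightarrow> bool" where
  "leA A a b \<longleftrightarrow> positive A (b - a)"

definition has_sumA :: "('a::ring) procstar \<Rightarrow> ('i \<Rightarrow> 'a) \<Rightarrow> 'i set \<Rightarrow> 'a \<Rightarrow> bool" where
  "has_sumA A f I s \<longleftrightarrow> sn_tendsto (seminorms A) (filtermap (sum f) (finite_subsets_at_top I)) s"

record ('a, 'x) hmodule =
  act :: "'a \<Rightarrow> 'x \<Rightarrow> 'x"
  xsmul :: "complex \<Rightarrow> 'x \<Rightarrow> 'x"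
  inner :: "'x \<Rightarrow> 'x \<Rightarrow> 'a"

definition xnorm :: "('a, 'x) hmodule \<Rightarrow> ('a \<Rightarrow> real) \<Rightarrow> 'x \<Rightarrow> real" where
  "xnorm X p \<xi> = sqrt (p (inner X \<xi> \<xi>))"

definition hilbert_module :: "('a::ring) procstar \<Rightarrow> ('a, 'x::ab_group_add) hmodule \<Rightarrow> bool" where
  "hilbert_module A X \<longleftrightarrow>
     pro_cstar_algebra A \<and>
     \<comment> \<open>left A-module and complex vector space, compatibly\<close>
     (\<forall>a b \<xi>. act X (a + b) \<xi> = act X a \<xi> + act X b \<xi>) \<and>
     (\<forall>a \<xi> \<eta>. act X a (\<xi> + \<eta>) = act X a \<xi> + act X a \<eta>) \<and>
     (\<forall>a b \<xi>. act X (a * b) \<xi> = act X a (act X b \<xi>)) \<and>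
     (\<forall>c \<xi> \<eta>. xsmul X c (\<xi> + \<eta>) = xsmul X c \<xi> + xsmul X c \<eta>) \<and>
     (\<forall>c d \<xi>. xsmul X (c + d) \<xi> = xsmul X c \<xi> + xsmul X d \<xi>) \<and>
     (\<forall>c d \<xi>. xsmul X (c * d) \<xi> = xsmul X c (xsmul X d \<xi>)) \<and>
     (\<forall>\<xi>. xsmul X 1 \<xi> = \<xi>) \<and>
     (\<forall>c a \<xi>. xsmul X c (act X a \<xi>) = act X (smul A c a) \<xi> \<and>
               xsmul X c (act X a \<xi>) = act X a (xsmul X c \<xi>)) \<and>
     \<comment> \<open>A-valued inner product\<close>
     (\<forall>\<xi> \<zeta> \<eta>. inner X (\<xi> + \<zeta>) \<eta> = inner X \<xi> \<eta> + inner X \<zeta> \<eta>) \<and>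
     (\<forall>c \<xi> \<eta>. inner X (xsmul X c \<xi>) \<eta> = smul A c (inner X \<xi> \<eta>)) \<and>
     (\<forall>a \<xi> \<eta>. inner X (act X a \<xi>) \<eta> = a * inner X \<xi> \<eta>) \<and>
     (\<forall>\<xi> \<eta>. star A (inner X \<xi> \<eta>) = inner X \<eta> \<xi>) \<and>
     (\<forall>\<xi>. positive A (inner X \<xi> \<xi>)) \<and>
     (\<forall>\<xi>. inner X \<xi> \<xi> = 0 \<longrightarrow> \<xi> = 0) \<and>
     \<comment> \<open>completeness for the seminorms p_X\<close>
     sn_complete ((\<lambda>p. xnorm X p) ` seminorms A)"

definition is_adjoint :: "('a, 'x) hmodule \<Rightarrow> ('x \<Rightarrow> 'x) \<Rightarrow> ('x \<Rightarrow> 'x) \<Rightarrow> bool" where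
  "is_adjoint X T T' \<longleftrightarrow> (\<forall>\<xi> \<eta>. inner X (T \<xi>) \<eta> = inner X \<xi> (T' \<eta>))"

definition adjoint :: "('a, 'x) hmodule \<Rightarrow> ('x \<Rightarrow> 'x) \<Rightarrow> 'x \<Rightarrow> 'x" where
  "adjoint X T = (SOME T'. is_adjoint X T T')"

definition Hom_star :: "('a::ring) procstar \<Rightarrow> ('a, 'x::ab_group_add) hmodule \<Rightarrow> ('x \<Rightarrow> 'x) set" where
  "Hom_star A X = {T.
     (\<forall>\<xi> \<eta>. T (\<xi> + \<eta>) = T \<xi> + T \<eta>) \<and>
     (\<forall>c \<xi>. T (xsmul X c \<xi>) = xsmul X c (T \<xi>)) \<and>
     (\<forall>a \<xi>. T (act X a \<xi>) = act X a (T \<xi>)) \<and>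
     (\<forall>p\<in>seminorms A. \<exists>M\<ge>0. \<forall>\<xi>. xnorm X p (T \<xi>) \<le> M * xnorm X p \<xi>) \<and>
     (\<exists>T'. is_adjoint X T T')}"

definition uniformly_bounded :: "('a::ring) procstar \<Rightarrow> ('a, 'x::ab_group_add) hmodule \<Rightarrow> ('x \<Rightarrow> 'x) \<Rightarrow> bool" where
  "uniformly_bounded A X T \<longleftrightarrow>
     (\<exists>C>0. \<forall>p\<in>seminorms A. \<forall>\<xi>. xnorm X p (T \<xi>) \<le> C * xnorm X p \<xi>)"

text \<open>Closure of a subset of X in the topology given by the seminorms p_X
  (the seminorm family is directed, so these sets form a neighbourhood base).\<close>

definition xclosure :: "('a::ring) procstar \<Rightarrow> ('a, 'x::ab_group_add) hmodule \<Rightarrow> 'x set \<Rightarrow> 'x set" where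
  "xclosure A X S = {\<xi>. \<forall>p\<in>seminorms A. \<forall>e>0. \<exists>\<eta>\<in>S. xnorm X p (\<xi> - \<eta>) < e}"

definition dense_in_X :: "('a::ring) procstar \<Rightarrow> ('a, 'x::ab_group_add) hmodule \<Rightarrow> 'x set \<Rightarrow> bool" where
  "dense_in_X A X S \<longleftrightarrow> xclosure A X S = UNIV"

definition closed_in_X :: "('a::ring) procstar \<Rightarrow> ('a, 'x::ab_group_add) hmodule \<Rightarrow> 'x set \<Rightarrow> bool" where
  "closed_in_X A X S \<longleftrightarrow> xclosure A X S \<subseteq> S"

definition K_frame :: "('a::ring) procstar \<Rightarrow> ('a, 'x::ab_group_add) hmodule \<Rightarrow> ('x \<Rightarrow> 'x)
                        \<Rightarrow> ('i \<Rightarrow> 'x) \<Rightarrow> 'i set \<Rightarrow> bool" where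
  "K_frame A X K f I \<longleftrightarrow>
     countable I \<and>
     (\<forall>\<xi>. \<exists>s. has_sumA A (\<lambda>i. inner X \<xi> (f i) * inner X (f i) \<xi>) I s) \<and>
     (\<exists>a b. a > 0 \<and> b > 0 \<and>
        (\<forall>\<xi> s. has_sumA A (\<lambda>i. inner X \<xi> (f i) * inner X (f i) \<xi>) I s \<longrightarrow>
            leA A (smul A (complex_of_real a)
                     (inner X (adjoint X K \<xi>) (adjoint X K \<xi>))) s \<and>
            leA A s (smul A (complex_of_real b) (inner X \<xi> \<xi>))))"

end

theory Submission
  imports Defs
begin

text \<open>The two frame inequalities combine to \<open>\<langle>K\<^sup>*\<xi>, K\<^sup>*\<xi>\<rangle> \<le> \<lambda>\<langle>T\<^sup>*\<xi>, T\<^sup>*\<xi>\<rangle>\<close>, and this alone puts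
  the range of \<open>K\<close> inside the closure of the range of \<open>T\<close>. Indeed, rescale \<open>T\<close> to a contraction
  and let \<open>W = 1 - TT\<^sup>*\<close>. Then \<open>x - W\<^sup>nx\<close> lies in the range of \<open>T\<close>, while the
  operators \<open>TT\<^sup>*W\<^sup>2\<^sup>n\<close> decrease and have sums bounded by the identity, so that
  \<open>n\<langle>T\<^sup>*W\<^sup>n\<xi>, T\<^sup>*W\<^sup>n\<xi>\<rangle> \<le> \<langle>\<xi>, \<xi>\<rangle>\<close> and hence \<open>W\<^sup>nK\<xi> \<rightarrow> 0\<close>. Neither the open mapping
  theorem nor complementability of the range of \<open>T\<close> is involved.

  The order enters only through the fact that a C*-seminorm is monotone on sums of elements
  \<open>c\<^sup>*c\<close>. It is proved, one seminorm at a time, by the argument of Kelley and Vaught in the algebra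
  of bounded operators \<open>A \<rightarrow> A\<close>. That algebra need not be complete, so square roots are
  approximated by polynomials and positivity of a self-adjoint \<open>k\<close> is expressed by
  \<open>\<parallel>t - k\<parallel> \<le> t + o(1)\<close> as \<open>t \<rightarrow> \<infinity>\<close>.\<close>

section \<open>Positivity in a unital algebra with a C*-seminorm\<close>

text \<open>Passes to the limit in an estimate whose error is proportional to
  \<open>\<epsilon>\<close>. Having it only for \<open>\<epsilon> < 1\<close> lets other factors be
  bounded by constants.\<close>

lemma le_of_forall_small:
  fixes a b C :: real
  assumes "\<And>\<epsilon>. 0 < \<epsilon> \<Longrightarrow> \<epsilon> < 1 \<Longrightarrow> a \<le> b + \<epsilon> * C" "C \<ge> 0"
  shows "a \<le> b"
proof (rule field_le_epsilon)
  fix e :: real assume e: "e > 0"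
  define \<epsilon> where "\<epsilon> = min (1/2) (e / (C + 1))"
  have "\<epsilon> > 0" "\<epsilon> < 1" using e assms(2) by (auto simp: \<epsilon>_def)
  hence "a \<le> b + \<epsilon> * C" by (rule assms(1))
  also have "\<epsilon> * C \<le> e / (C + 1) * (C + 1)"
    using e assms(2) by (intro mult_mono) (auto simp: \<epsilon>_def)
  finally show "a \<le> b + e" using assms(2) by simp
qed

text \<open>Adjoints form a relation, whose domain serves as the carrier of the algebra.\<close>

locale cstar_unital =
  fixes adj :: "'r::{ring, monoid_mult} \<Rightarrow> 'r \<Rightarrow> bool"
    and sc :: "complex \<Rightarrow> 'r"
    and nm :: "'r \<Rightarrow> real"
  assumes adj_sym: "adj x y \<Longrightarrow> adj y x"
    and adj_add: "adj x x' \<Longrightarrow> adj y y' \<Longrightarrow> adj (x + y) (x' + y')"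
    and adj_mult: "adj x x' \<Longrightarrow> adj y y' \<Longrightarrow> adj (x * y) (y' * x')"
    and adj_sc: "adj (sc c) (sc (cnj c))"
    and sc_add: "sc (a + b) = sc a + sc b"
    and sc_mult: "sc (a * b) = sc a * sc b"
    and sc_1: "sc 1 = 1"
    and sc_comm: "adj x y \<Longrightarrow> x * sc c = sc c * x"
    and nm_triangle: "adj x x' \<Longrightarrow> adj y y' \<Longrightarrow> nm (x + y) \<le> nm x + nm y"
    and nm_mult: "adj x x' \<Longrightarrow> adj y y' \<Longrightarrow> nm (x * y) \<le> nm x * nm y"
    and nm_sc: "adj x x' \<Longrightarrow> nm (sc c * x) = cmod c * nm x"
    and nm_1: "nm 1 \<le> 1"
    and nm_nonneg: "nm x \<ge> 0"
    and nm_star: "adj x x' \<Longrightarrow> (nm x)\<^sup>2 \<le> nm (x' * x)"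
begin

section \<open>Real scalars and the rules for adjoints and the seminorm\<close>

definition rl :: "real \<Rightarrow> 'r" where "rl t = sc (complex_of_real t)"

lemma sc_0: "sc 0 = 0"
  using sc_add[of 0 0] by simp

lemma sc_minus: "sc (- a) = - sc a"
  using sc_add[of a "- a"] sc_0 by (simp add: add_eq_0_iff)

lemma rl_add: "rl (a + b) = rl a + rl b"
  by (simp add: rl_def sc_add)

lemma rl_mult: "rl (a * b) = rl a * rl b"
  by (simp add: rl_def sc_mult)

lemma rl_minus: "rl (- a) = - rl a"
  by (simp add: rl_def sc_minus)

lemma rl_diff: "rl (a - b) = rl a - rl b"
  using rl_add[of a "- b"] rl_minus by simp

lemma rl_1: "rl 1 = 1" and rl_0: "rl 0 = 0"
  by (simp_all add: rl_def sc_1 sc_0)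

lemma rl_2: "rl 2 * u = u + u"
  using rl_add[of 1 1] rl_1 by (simp add: distrib_right)

lemma rl_half: "rl (1/2) * (rl 2 * u) = u" "rl 2 * (rl (1/2) * u) = u"
  using rl_mult[of "1/2" 2] rl_mult[of 2 "1/2"] rl_1 by (simp_all add: mult.assoc[symmetric])

lemma rl_halves: "rl t = rl (t / 2) + rl (t / 2)"
  by (simp flip: rl_add)

lemma rl_sqrt: "t \<ge> 0 \<Longrightarrow> rl (sqrt t) * rl (sqrt t) = rl t"
  by (simp flip: rl_mult)

lemma adj_rl: "adj (rl t) (rl t)"
  using adj_sc[of "complex_of_real t"] by (simp add: rl_def)

lemma rl_comm: "adj x y \<Longrightarrow> x * rl c = rl c * x"
  by (simp add: rl_def sc_comm)

lemma adj_uminus: "adj x x' \<Longrightarrow> adj (- x) (- x')"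
  using adj_mult[OF adj_rl[of "-1"], of x x'] rl_comm[of x' x "-1"] adj_sym[of x x']
  by (simp add: rl_minus rl_1)

lemma adj_diff: "adj x x' \<Longrightarrow> adj y y' \<Longrightarrow> adj (x - y) (x' - y')"
  using adj_add[OF _ adj_uminus] by fastforce

lemma adj_1: "adj 1 1"
  using adj_rl[of 1] rl_1 by simp

lemma adj_0: "adj 0 0"
  using adj_rl[of 0] rl_0 by simp

lemma adj_scale: "adj x x' \<Longrightarrow> adj (rl t * x) (rl t * x')"
  using adj_mult[OF adj_rl[of t], of x x'] rl_comm[of x' x] adj_sym[of x x'] by simp

lemmas adjs = adj_add adj_diff adj_uminus adj_rl adj_1 adj_0 adj_scale

lemma sc_left_comm: "adj x y \<Longrightarrow> x * (sc c * z) = sc c * (x * z)"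
  by (metis sc_comm mult.assoc)

lemma rl_left_comm: "adj x y \<Longrightarrow> x * (rl c * z) = rl c * (x * z)"
  by (simp add: rl_def sc_left_comm)

lemma nm_minus: "adj x x' \<Longrightarrow> nm (- x) = nm x"
  using nm_sc[of x x' "-1"] by (simp add: sc_minus sc_1)

lemma nm_diff: "adj x x' \<Longrightarrow> adj y y' \<Longrightarrow> nm (x - y) \<le> nm x + nm y"
  using nm_triangle[OF _ adj_uminus, of x x' y y'] nm_minus by fastforce

lemma nm_scale: "adj x x' \<Longrightarrow> nm (rl t * x) = \<bar>t\<bar> * nm x"
  using nm_sc[of x x' "complex_of_real t"] by (simp add: rl_def)

lemma nm_rl: "nm (rl t) \<le> \<bar>t\<bar>"
  using nm_scale[OF adj_1, of t] nm_1 by (simp add: mult_left_le)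

lemma nm_adj_le: assumes "adj x x'" shows "nm x \<le> nm x'"
proof (cases "nm x = 0")
  case False
  have "nm x * nm x \<le> nm x' * nm x"
    using nm_star[OF assms] nm_mult[OF adj_sym[OF assms] assms] by (simp add: power2_eq_square)
  thus ?thesis using False nm_nonneg[of x] by simp
qed (simp add: nm_nonneg)

lemma nm_adj: "adj x x' \<Longrightarrow> nm x' = nm x"
  using nm_adj_le[of x x'] nm_adj_le[of x' x] adj_sym by fastforce

lemma nm_sa_square: "adj h h \<Longrightarrow> (nm h)\<^sup>2 \<le> nm (h * h)"
  by (rule nm_star)

text \<open>For commuting self-adjoint \<open>v\<close> and \<open>w\<close>, the element
  \<open>z = v + iw\<close> satisfies \<open>z'z = v^2 + w^2\<close> and has \<open>v\<close> as its
  real part, so \<open>nm v \<le> nm z\<close>. This device replaces the spectrum in the norm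
  estimates below.\<close>

lemma nm_le_sum_squares:
  assumes v: "adj v v" and w: "adj w w" and c: "v * w = w * v"
  shows "(nm v)\<^sup>2 \<le> nm (v * v + w * w)"
proof -
  define z where "z = v + sc \<i> * w"
  define z' where "z' = v - sc \<i> * w"
  have "adj (sc \<i> * w) (w * sc (cnj \<i>))" using adj_mult[OF adj_sc w] .
  hence "adj (sc \<i> * w) (- (sc \<i> * w))" using sc_comm[OF w] by (simp add: sc_minus)
  hence zz: "adj z z'" unfolding z_def z'_def using adj_add[OF v] by fastforce
  have ii: "sc \<i> * sc \<i> = - 1" using sc_mult[of \<i> \<i>] sc_minus[of 1] sc_1 by simp
  have "sc \<i> * (w * (sc \<i> * w)) = (sc \<i> * sc \<i>) * (w * w)"
    using sc_left_comm[OF w] by (simp add: mult.assoc)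
  hence "z' * z = v * v + w * w"
    unfolding z_def z'_def using sc_left_comm[OF v] sc_comm[OF v] c ii
    by (simp add: algebra_simps)
  hence 1: "(nm z)\<^sup>2 \<le> nm (v * v + w * w)" using nm_star[OF zz] by simp
  have "rl 2 * v = z + z'" unfolding z_def z'_def
    by (simp add: rl_2)
  hence "2 * nm v \<le> nm z + nm z'" using nm_triangle[OF zz adj_sym[OF zz]] nm_scale[OF v, of 2] by simp
  hence "nm v \<le> nm z" using nm_adj[OF zz] by simp
  thus ?thesis using 1 power_mono[OF _ nm_nonneg, of v "nm z" 2] by fastforce
qed

section \<open>Approximately positive elements and their square roots\<close>

text \<open>In a C*-algebra the inequality confines the spectrum of \<open>k\<close> to
  \<open>[-\<delta>, 2t + \<delta>]\<close>. Letting \<open>t\<close> depend on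
  \<open>\<delta>\<close> makes the condition accessible for squares, where the available estimate
  improves as \<open>t\<close> grows.\<close>

definition Pos :: "'r \<Rightarrow> bool" where
  "Pos k \<longleftrightarrow> adj k k \<and> (\<forall>\<delta>>0. \<exists>t\<ge>0. nm (rl t - k) \<le> t + \<delta>)"

lemma Pos_adj: "Pos k \<Longrightarrow> adj k k" by (simp add: Pos_def)

lemma PosI: "adj k k \<Longrightarrow> t \<ge> 0 \<Longrightarrow> nm (rl t - k) \<le> t \<Longrightarrow> Pos k"
  unfolding Pos_def by (smt (verit))

lemma Pos_add: assumes "Pos k" "Pos l" shows "Pos (k + l)"
  unfolding Pos_def
proof (intro conjI allI impI)
  note a = Pos_adj[OF assms(1)] Pos_adj[OF assms(2)]
  show "adj (k + l) (k + l)" using adj_add a by blast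
  fix \<delta> :: real assume "\<delta> > 0"
  hence d: "\<delta> / 2 > 0" by simp
  obtain t u where t: "t \<ge> 0" "nm (rl t - k) \<le> t + \<delta> / 2" and u: "u \<ge> 0" "nm (rl u - l) \<le> u + \<delta> / 2"
    using assms d unfolding Pos_def by meson
  have "rl (t + u) - (k + l) = (rl t - k) + (rl u - l)" by (simp add: rl_add)
  hence "nm (rl (t + u) - (k + l)) \<le> nm (rl t - k) + nm (rl u - l)"
    using nm_triangle[OF adj_diff[OF adj_rl a(1)] adj_diff[OF adj_rl a(2)]] by metis
  thus "\<exists>t\<ge>0. nm (rl t - (k + l)) \<le> t + \<delta>"
    using t u by (intro exI[of _ "t + u"]) auto
qed

lemma Pos_scale: assumes "Pos k" "c > 0" shows "Pos (rl c * k)"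
  unfolding Pos_def
proof (intro conjI allI impI)
  note a = Pos_adj[OF assms(1)]
  show "adj (rl c * k) (rl c * k)" using adj_scale a by blast
  fix \<delta> :: real assume "\<delta> > 0"
  hence "\<delta> / c > 0" using assms by simp
  then obtain t where t: "t \<ge> 0" "nm (rl t - k) \<le> t + \<delta> / c"
    using assms unfolding Pos_def by meson
  have "rl (c * t) - rl c * k = rl c * (rl t - k)" by (simp add: rl_mult algebra_simps)
  hence "nm (rl (c * t) - rl c * k) = c * nm (rl t - k)"
    using nm_scale[OF adj_diff[OF adj_rl a]] assms(2) by simp
  also have "\<dots> \<le> c * (t + \<delta> / c)" using t assms by (intro mult_left_mono) auto
  finally show "\<exists>t\<ge>0. nm (rl t - rl c * k) \<le> t + \<delta>"
    using t assms by (intro exI[of _ "c * t"]) (auto simp: algebra_simps)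
qed

lemma Pos_limit:
  assumes k: "adj k k" and ex: "\<And>\<epsilon>. \<epsilon> > 0 \<Longrightarrow> \<exists>l. Pos l \<and> nm (k - l) \<le> \<epsilon>"
  shows "Pos k"
  unfolding Pos_def
proof (intro conjI allI impI k)
  fix \<delta> :: real assume "\<delta> > 0"
  hence d: "\<delta> / 2 > 0" by simp
  obtain l where l: "Pos l" "nm (k - l) \<le> \<delta> / 2" using ex[OF d] by blast
  obtain t where t: "t \<ge> 0" "nm (rl t - l) \<le> t + \<delta> / 2" using l d unfolding Pos_def by meson
  have "rl t - k = (rl t - l) - (k - l)" by simp
  hence "nm (rl t - k) \<le> nm (rl t - l) + nm (k - l)"
    using nm_diff[OF adj_diff[OF adj_rl Pos_adj[OF l(1)]] adj_diff[OF k Pos_adj[OF l(1)]]] by metis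
  thus "\<exists>t\<ge>0. nm (rl t - k) \<le> t + \<delta>" using t l by (intro exI[of _ t]) auto
qed

lemma Pos_rl_diff: assumes "adj k k" "nm k \<le> \<beta>" shows "Pos (rl \<beta> - k)"
  using assms nm_nonneg[of k] by (intro PosI[of _ \<beta>] adjs) auto

text \<open>With \<open>v = t - h^2\<close> and \<open>w = sqrt (2t) h\<close> the mixed terms
  cancel: \<open>v^2 + w^2 = t^2 + h^4\<close>. So \<open>(nm v)^2\<close> is at most
  \<open>t^2 + n\<close>, which \<open>(t + \<delta>)^2\<close> exceeds because
  \<open>t = n / \<delta>\<close> gives \<open>2 t \<delta> = 2n\<close>.\<close>

lemma Pos_square: assumes h: "adj h h" shows "Pos (h * h)"
  unfolding Pos_def
proof (intro conjI allI impI)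
  have hh: "adj (h * h) (h * h)" by (rule adj_mult[OF h h])
  show "adj (h * h) (h * h)" by (rule hh)
  fix \<delta> :: real assume d: "\<delta> > 0"
  define n where "n = (nm h)^4"
  define t where "t = n / \<delta>"
  have n0: "n \<ge> 0" unfolding n_def by simp
  have t0: "t \<ge> 0" using d n0 by (simp add: t_def)
  define v where "v = rl t - h * h"
  define w where "w = rl (sqrt (2 * t)) * h"
  have v: "adj v v" unfolding v_def by (intro adjs hh)
  have w: "adj w w" unfolding w_def by (intro adjs h)
  have c: "v * w = w * v" unfolding v_def w_def
    using rl_comm[OF h] rl_left_comm[OF h] rl_left_comm[OF adj_rl, of t "sqrt (2 * t)" h]
    by (simp add: algebra_simps)
  have "w * w = (rl (sqrt (2 * t)) * rl (sqrt (2 * t))) * (h * h)"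
    unfolding w_def using rl_left_comm[OF h] by (simp add: mult.assoc)
  also have "rl (sqrt (2 * t)) * rl (sqrt (2 * t)) = rl (2 * t)"
    using t0 by (simp add: rl_sqrt)
  also have "\<dots> = rl t + rl t" by (simp flip: rl_add)
  finally have ww: "w * w = (rl t + rl t) * (h * h)" .
  have e: "v * v + w * w = rl (t * t) + (h * h) * (h * h)"
    unfolding ww v_def using rl_comm[OF h] rl_left_comm[OF h] by (simp add: rl_mult algebra_simps)
  have "nm ((h * h) * (h * h)) \<le> nm (h * h) * nm (h * h)" using nm_mult[OF hh hh] .
  also have "\<dots> \<le> (nm h * nm h) * (nm h * nm h)"
    using nm_mult[OF h h] by (intro mult_mono) (auto simp: nm_nonneg)
  also have "\<dots> = n" unfolding n_def by (simp add: power4_eq_xxxx)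
  finally have "(nm v)\<^sup>2 \<le> t * t + n"
    using nm_le_sum_squares[OF v w c] nm_triangle[OF adj_rl[of "t * t"] adj_mult[OF hh hh]] nm_rl[of "t * t"]
    unfolding e by (simp add: abs_of_nonneg[OF mult_nonneg_nonneg[OF t0 t0]])
  also have "\<dots> \<le> (t + \<delta>)\<^sup>2"
    using d n0 unfolding t_def by (simp add: power2_eq_square field_simps)
  finally have "nm v \<le> t + \<delta>" by (rule power2_le_imp_le) (use t0 d in simp)
  thus "\<exists>t\<ge>0. nm (rl t - h * h) \<le> t + \<delta>" using t0 unfolding v_def by blast
qed

text \<open>Converges to \<open>1 - sqrt (1 - x)\<close>, the fixed point of \<open>y \<mapsto> (x + y\<^sup>2) / 2\<close>.\<close>

primrec sqrt_iter :: "'r \<Rightarrow> nat \<Rightarrow> 'r" where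
  "sqrt_iter x 0 = 0"
| "sqrt_iter x (Suc n) = rl (1/2) * (x + sqrt_iter x n * sqrt_iter x n)"

lemma adj_sqrt_iter: "adj x x \<Longrightarrow> adj (sqrt_iter x n) (sqrt_iter x n)"
  by (induction n) (auto intro!: adj_scale adj_add adj_mult adj_0)

lemma sqrt_iter_comm:
  assumes z: "adj z z'" and c: "z * x = x * z"
  shows "z * sqrt_iter x n = sqrt_iter x n * z"
proof (induction n)
  case (Suc n)
  let ?y = "sqrt_iter x n"
  have "z * (?y * ?y) = ?y * ?y * z" using Suc by (metis mult.assoc)
  hence "z * (x + ?y * ?y) = (x + ?y * ?y) * z" using c by (simp add: algebra_simps)
  thus ?case using rl_left_comm[OF z] by (simp add: mult.assoc)
qed simp

lemma nm_sqrt_iter: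
  assumes x: "adj x x" and r: "nm x \<le> \<rho>" "\<rho> < 1"
  shows "nm (sqrt_iter x n) \<le> \<rho>"
proof (induction n)
  case 0
  have "nm 0 = 0" using nm_scale[OF adj_0, of 0] by simp
  thus ?case using r nm_nonneg[of x] by simp
next
  case (Suc n)
  let ?y = "sqrt_iter x n"
  have y: "adj ?y ?y" using adj_sqrt_iter[OF x] .
  have "nm (?y * ?y) \<le> \<rho> * 1"
    using nm_mult[OF y y] mult_mono[of "nm ?y" \<rho> "nm ?y" 1] Suc r nm_nonneg[of ?y] by simp
  hence "nm (x + ?y * ?y) \<le> \<rho> + \<rho>" using nm_triangle[OF x adj_mult[OF y y]] r by simp
  thus ?case using nm_scale[OF adj_add[OF x adj_mult[OF y y]], of "1/2"] by simp
qed

text \<open>Iterates are polynomials in \<open>x\<close> and commute, so each difference is half of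
  \<open>(z - y) * (z + y)\<close> for the two preceding iterates; the second factor has norm at
  most \<open>2 * \<rho>\<close>.\<close>

lemma nm_sqrt_iter_diff:
  assumes x: "adj x x" and r: "nm x \<le> \<rho>" "\<rho> < 1"
  shows "nm (sqrt_iter x (Suc n) - sqrt_iter x n) \<le> \<rho> ^ n"
proof (induction n)
  case 0
  have "nm (rl (1/2) * x) \<le> 1" using nm_scale[OF x, of "1/2"] r nm_nonneg[of x] by simp
  thus ?case by simp
next
  case (Suc n)
  let ?y = "sqrt_iter x n" and ?z = "sqrt_iter x (Suc n)"
  have y: "adj ?y ?y" and z: "adj ?z ?z" using adj_sqrt_iter[OF x] by blast+
  have "?y * x = x * ?y" using sqrt_iter_comm[OF x refl] by simp
  hence "?y * ?z = ?z * ?y" by (rule sqrt_iter_comm[OF y])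
  hence "sqrt_iter x (Suc (Suc n)) - ?z = rl (1/2) * ((?z - ?y) * (?z + ?y))"
    by (simp add: algebra_simps)
  hence "nm (sqrt_iter x (Suc (Suc n)) - ?z) = nm ((?z - ?y) * (?z + ?y)) / 2"
    using nm_scale[OF adj_mult[OF adj_diff[OF z y] adj_add[OF z y]], of "1/2"] by simp
  also have "\<dots> \<le> \<rho> ^ n * (\<rho> + \<rho>) / 2"
  proof -
    have "nm (?z + ?y) \<le> \<rho> + \<rho>"
      using nm_triangle[OF z y] nm_sqrt_iter[OF assms, of n] nm_sqrt_iter[OF assms, of "Suc n"] by linarith
    hence "nm ((?z - ?y) * (?z + ?y)) \<le> \<rho> ^ n * (\<rho> + \<rho>)"
      using nm_mult[OF adj_diff[OF z y] adj_add[OF z y]]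
        mult_mono[OF Suc, of "nm (?z + ?y)" "\<rho> + \<rho>"] nm_nonneg r nm_nonneg[of x]
      by (smt (verit) zero_le_power)
    thus ?thesis by simp
  qed
  finally show ?case by (simp add: algebra_simps)
qed

text \<open>The iteration is run on \<open>x = (t - k) / \<tau>\<close> and stopped, so
  \<open>s\<close> is a polynomial in \<open>k\<close>. The commutation clause keeps what is needed
  of this: it makes approximate roots of commuting elements commute.\<close>

lemma Pos_sqrt:
  assumes k: "Pos k" and e: "\<epsilon> > 0"
  shows "\<exists>s. Pos s \<and> nm (s * s - k) \<le> \<epsilon> \<and> (\<forall>z z'. adj z z' \<and> z * k = k * z \<longrightarrow> z * s = s * z)"
proof -
  note ka = Pos_adj[OF k]
  \<comment> \<open>One half of \<open>\<epsilon>\<close> pays for enlarging \<open>t\<close> to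
    \<open>\<tau>\<close>, the other half for stopping the iteration.\<close>
  define \<delta> where "\<delta> = \<epsilon> / 4"
  have d: "\<delta> > 0" using e by (simp add: \<delta>_def)
  obtain t where t: "t \<ge> 0" "nm (rl t - k) \<le> t + \<delta>" using k d unfolding Pos_def by meson
  \<comment> \<open>Larger than \<open>t + \<delta>\<close>, so that \<open>\<rho> < 1\<close>; in
    exchange \<open>\<tau> (1 - x)\<close> is \<open>k + 2 \<delta>\<close> instead of
    \<open>k\<close>.\<close>
  define \<tau> where "\<tau> = t + 2 * \<delta>"
  have tau: "\<tau> > 0" using t d by (simp add: \<tau>_def)
  define x where "x = rl (1 / \<tau>) * (rl t - k)"
  have x: "adj x x" unfolding x_def by (intro adjs ka)
  define \<rho> where "\<rho> = (t + \<delta>) / \<tau>"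
  have rho: "\<rho> < 1" "\<rho> \<ge> 0" using t d by (auto simp: \<rho>_def \<tau>_def)
  have xr: "nm x \<le> \<rho>"
    unfolding x_def using nm_scale[OF adj_diff[OF adj_rl[of t] ka], of "1 / \<tau>"] t tau
    by (simp add: \<rho>_def divide_right_mono)
  have "(\<lambda>n. \<rho> ^ n) \<longlonglongrightarrow> 0" using rho by (intro LIMSEQ_power_zero) auto
  hence "\<forall>\<^sub>F n in sequentially. \<rho> ^ n < \<delta> / \<tau>" by (rule order_tendstoD) (use d tau in auto)
  then obtain n where n: "\<rho> ^ n < \<delta> / \<tau>" by (auto simp: eventually_sequentially)
  define y where "y = sqrt_iter x n"
  define y' where "y' = sqrt_iter x (Suc n)"
  have y: "adj y y" and y': "adj y' y'" unfolding y_def y'_def using adj_sqrt_iter[OF x] by blast+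
  have yr: "nm y \<le> 1" using nm_sqrt_iter[OF x xr rho(1), of n] rho unfolding y_def by simp
  define s where "s = rl (sqrt \<tau>) * (1 - y)"
  have sa: "adj s s" unfolding s_def by (intro adjs y)
  have "rl (sqrt \<tau>) - s = rl (sqrt \<tau>) * y" unfolding s_def by (simp add: algebra_simps)
  hence "nm (rl (sqrt \<tau>) - s) \<le> sqrt \<tau>" using nm_scale[OF y, of "sqrt \<tau>"] yr tau
    by (simp add: mult_left_le)
  hence sP: "Pos s" using tau by (intro PosI[of _ "sqrt \<tau>"] sa) auto
  have "s * s = (rl (sqrt \<tau>) * rl (sqrt \<tau>)) * ((1 - y) * (1 - y))"
    unfolding s_def using rl_left_comm[OF adj_diff[OF adj_1 y]] by (simp add: mult.assoc)
  also have "rl (sqrt \<tau>) * rl (sqrt \<tau>) = rl \<tau>"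
    using tau by (simp add: rl_sqrt)
  finally have ss: "s * s = rl \<tau> * ((1 - y) * (1 - y))" .
  have "y' = rl (1/2) * (x + y * y)" unfolding y_def y'_def by simp
  hence "y' + y' = x + y * y" using rl_half(2)[of "x + y * y"] rl_2[of y'] by simp
  \<comment> \<open>The error of \<open>1 - y\<close> as a square root of \<open>1 - x\<close> is
    twice the defect \<open>y' - y\<close> of the fixed-point equation.\<close>
  hence yy: "(1 - y) * (1 - y) = (1 - x) + rl 2 * (y' - y)" unfolding rl_2 by (simp add: algebra_simps)
  have "s * s = rl \<tau> * (1 - x) + rl (\<tau> * 2) * (y' - y)"
    unfolding ss yy by (simp only: rl_mult distrib_left mult.assoc)
  hence "s * s - k = rl \<tau> - rl \<tau> * x - k + rl (\<tau> * 2) * (y' - y)" by (simp add: right_diff_distrib)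
  moreover have "rl \<tau> * x = rl t - k"
    unfolding x_def using tau rl_mult[of \<tau> "1 / \<tau>"] rl_1
    by (simp add: mult.assoc[symmetric])
  ultimately have "s * s - k = rl (2 * \<delta>) + rl (\<tau> * 2) * (y' - y)"
    by (simp add: \<tau>_def[THEN arg_cong[where f = rl]] rl_add)
  hence "nm (s * s - k) \<le> nm (rl (2 * \<delta>)) + nm (rl (\<tau> * 2) * (y' - y))"
    using nm_triangle[OF adj_rl[of "2 * \<delta>"] adj_scale[OF adj_diff[OF y' y], of "\<tau> * 2"]] by simp
  also have "\<dots> \<le> 2 * \<delta> + \<tau> * 2 * nm (y' - y)"
    using nm_rl[of "2 * \<delta>"] nm_scale[OF adj_diff[OF y' y], of "\<tau> * 2"] d tau by simp
  also have "\<tau> * 2 * nm (y' - y) \<le> \<tau> * 2 * (\<delta> / \<tau>)"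
    using nm_sqrt_iter_diff[OF x xr rho(1), of n] n tau unfolding y_def y'_def
    by (intro mult_left_mono) auto
  also have "2 * \<delta> + \<tau> * 2 * (\<delta> / \<tau>) = \<epsilon>" using tau by (simp add: \<delta>_def)
  finally have "nm (s * s - k) \<le> \<epsilon>" by simp
  moreover have "z * s = s * z" if z: "adj z z'" and c: "z * k = k * z" for z z'
  proof -
    have "z * x = x * z" unfolding x_def
      using c rl_left_comm[OF z] rl_comm[OF z] by (simp add: algebra_simps)
    hence "z * y = y * z" unfolding y_def by (rule sqrt_iter_comm[OF z])
    thus ?thesis unfolding s_def using rl_left_comm[OF z] rl_comm[OF z] by (simp add: algebra_simps)
  qed
  ultimately show ?thesis using sP by blast
qed

section \<open>Norm bounds from positivity\<close>

text \<open>With \<open>l' = \<beta> - k\<close> and \<open>v = k - \<beta>/2\<close> one has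
  \<open>v^2 + k l' = (\<beta>/2)^2\<close>, and \<open>k l'\<close> is nearly the square of the
  product of two commuting approximate roots, so the sum-of-squares bound applies.\<close>

lemma Pos_bound:
  assumes k: "Pos k" and l: "Pos (rl \<beta> - k)" and b: "\<beta> \<ge> 0"
  shows "nm (k - rl (\<beta> / 2)) \<le> \<beta> / 2"
proof -
  define l' where "l' = rl \<beta> - k"
  note ka = Pos_adj[OF k]
  have la: "adj l' l'" unfolding l'_def using Pos_adj[OF l] .
  define v where "v = k - rl (\<beta> / 2)"
  have v: "adj v v" unfolding v_def by (intro adjs ka)
  have "(nm v)\<^sup>2 \<le> (\<beta> / 2)\<^sup>2"
  proof (rule le_of_forall_small)
    show "nm l' + 1 + nm k \<ge> 0" using nm_nonneg[of l'] nm_nonneg[of k] by linarith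
    fix \<epsilon> :: real assume e: "0 < \<epsilon>" "\<epsilon> < 1"
    obtain s where s: "Pos s" "nm (s * s - k) \<le> \<epsilon>"
      and sc': "\<And>z z'. adj z z' \<Longrightarrow> z * k = k * z \<Longrightarrow> z * s = s * z"
      using Pos_sqrt[OF k e(1)] by blast
    obtain q where q: "Pos q" "nm (q * q - l') \<le> \<epsilon>"
      and qc: "\<And>z z'. adj z z' \<Longrightarrow> z * l' = l' * z \<Longrightarrow> z * q = q * z"
      using Pos_sqrt[OF l e(1)] unfolding l'_def by blast
    note sa = Pos_adj[OF s(1)] and qa = Pos_adj[OF q(1)]
    have ks: "k * s = s * k" using sc'[OF ka] by simp
    have "s * l' = l' * s" unfolding l'_def using ks rl_comm[OF sa] by (simp add: algebra_simps)
    hence sq: "s * q = q * s" using qc[OF sa] by simp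
    have "k * l' = l' * k" unfolding l'_def using rl_comm[OF ka] by (simp add: algebra_simps)
    hence kq: "k * q = q * k" using qc[OF ka] by simp
    define w where "w = s * q"
    have w: "adj w w" unfolding w_def using adj_mult[OF sa qa] sq by simp
    have kw: "k * w = w * k" unfolding w_def by (metis ks kq mult.assoc)
    have c: "v * w = w * v" unfolding v_def using kw rl_comm[OF w] by (simp add: algebra_simps)
    have vv: "v * v = rl ((\<beta> / 2)\<^sup>2) - k * l'"
      unfolding v_def l'_def power2_eq_square rl_mult rl_halves[of \<beta>]
      using rl_comm[OF ka] by (simp add: algebra_simps)
    have ww: "w * w = (s * s) * (q * q)" unfolding w_def by (metis sq mult.assoc)
    have e1: "v * v + w * w = rl ((\<beta> / 2)\<^sup>2) + ((s * s - k) * (q * q) + k * (q * q - l'))"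
      unfolding vv ww by (simp add: algebra_simps)
    have ss: "adj (s * s - k) (s * s - k)" and qq: "adj (q * q) (q * q)"
      and qql: "adj (q * q - l') (q * q - l')"
      by (intro adjs adj_mult sa qa ka la)+
    have "nm (q * q) \<le> nm (q * q - l') + nm l'" using nm_triangle[OF qql la] by simp
    hence nq: "nm (q * q) \<le> nm l' + 1" using q e by linarith
    have "nm ((s * s - k) * (q * q)) \<le> \<epsilon> * (nm l' + 1)"
      using nm_mult[OF ss qq] mult_mono[OF s(2) nq] e nm_nonneg by (smt (verit))
    moreover have "nm (k * (q * q - l')) \<le> nm k * \<epsilon>"
      using nm_mult[OF ka qql] mult_left_mono[OF q(2) nm_nonneg[of k]] by linarith
    moreover have "nm ((s * s - k) * (q * q) + k * (q * q - l')) \<le> nm ((s * s - k) * (q * q)) + nm (k * (q * q - l'))"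
      by (rule nm_triangle[OF adj_mult[OF ss qq] adj_mult[OF ka qql]])
    moreover have "nm (v * v + w * w) \<le> nm (rl ((\<beta> / 2)\<^sup>2)) + nm ((s * s - k) * (q * q) + k * (q * q - l'))"
      unfolding e1 by (rule nm_triangle[OF adj_rl adj_add[OF adj_mult[OF ss qq] adj_mult[OF ka qql]]])
    moreover have "nm (rl ((\<beta> / 2)\<^sup>2)) \<le> (\<beta> / 2)\<^sup>2" using nm_rl[of "(\<beta> / 2)\<^sup>2"] by simp
    moreover have "(nm v)\<^sup>2 \<le> nm (v * v + w * w)" by (rule nm_le_sum_squares[OF v w c])
    moreover have "\<epsilon> * (nm l' + 1 + nm k) = \<epsilon> * (nm l' + 1) + nm k * \<epsilon>" by (simp add: algebra_simps)
    ultimately show "(nm v)\<^sup>2 \<le> (\<beta> / 2)\<^sup>2 + \<epsilon> * (nm l' + 1 + nm k)" by linarith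
  qed
  thus ?thesis unfolding v_def by (rule power2_le_imp_le) (use b in simp)
qed

lemma nm_le_Pos:
  assumes k: "Pos k" and l: "Pos (rl \<beta> - k)" and b: "\<beta> \<ge> 0"
  shows "nm k \<le> \<beta>"
proof -
  have "nm k \<le> nm (k - rl (\<beta> / 2)) + nm (rl (\<beta> / 2))"
    using nm_triangle[OF adj_diff[OF Pos_adj[OF k] adj_rl[of "\<beta> / 2"]] adj_rl[of "\<beta> / 2"]] by simp
  thus ?thesis using Pos_bound[OF assms] nm_rl[of "\<beta> / 2"] b by simp
qed

text \<open>For \<open>\<beta> = nm (k + l)\<close> the element \<open>\<beta> - k\<close> is the
  sum of the positive elements \<open>\<beta> - (k + l)\<close> and \<open>l\<close>.\<close>

lemma nm_mono_Pos: assumes k: "Pos k" and l: "Pos l" shows "nm k \<le> nm (k + l)"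
proof (rule nm_le_Pos[OF k])
  have "Pos (rl (nm (k + l)) - (k + l) + l)"
    by (intro Pos_add l Pos_rl_diff adj_add Pos_adj[OF k] Pos_adj[OF l]) simp
  thus "Pos (rl (nm (k + l)) - k)" by simp
qed (rule nm_nonneg)

text \<open>Replacing \<open>s\<close> by \<open>q * q\<close>, with \<open>q\<close> an approximate
  root commuting with \<open>g\<close>, turns the product into the square of
  \<open>q * g\<close>.\<close>

lemma Pos_mult_square:
  assumes s: "Pos s" and g: "adj g g" and c: "s * g = g * s"
  shows "Pos (s * (g * g))"
proof (rule Pos_limit)
  note sa = Pos_adj[OF s]
  have gg: "adj (g * g) (g * g)" by (rule adj_mult[OF g g])
  have "s * (g * g) = g * g * s" by (metis c mult.assoc)
  thus a: "adj (s * (g * g)) (s * (g * g))" using adj_mult[OF sa gg] by simp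
  fix \<epsilon> :: real assume e: "\<epsilon> > 0"
  define d where "d = \<epsilon> / (nm (g * g) + 1)"
  have g0: "nm (g * g) \<ge> 0" by (rule nm_nonneg)
  have d: "d > 0" using e g0 by (simp add: d_def)
  obtain q where q: "Pos q" "nm (q * q - s) \<le> d"
    and qc: "\<And>z z'. adj z z' \<Longrightarrow> z * s = s * z \<Longrightarrow> z * q = q * z"
    using Pos_sqrt[OF s d] by blast
  note qa = Pos_adj[OF q(1)]
  have gq: "g * q = q * g" using qc[OF g] c by simp
  have w: "adj (q * g) (q * g)" using adj_mult[OF qa g] gq by simp
  have qs: "adj (q * q - s) (q * q - s)" by (intro adjs adj_mult qa sa)
  have "(q * g) * (q * g) = q * q * (g * g)" by (metis gq mult.assoc)
  hence "s * (g * g) - (q * g) * (q * g) = - ((q * q - s) * (g * g))" by (simp add: algebra_simps)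
  hence "nm (s * (g * g) - (q * g) * (q * g)) = nm ((q * q - s) * (g * g))"
    using nm_minus[OF adj_mult[OF qs gg]] by simp
  also have "\<dots> \<le> d * nm (g * g)" using nm_mult[OF qs gg] mult_right_mono[OF q(2) g0] by linarith
  also have "\<dots> \<le> \<epsilon>" using e g0 by (simp add: d_def field_simps)
  finally show "\<exists>l. Pos l \<and> nm (s * (g * g) - l) \<le> \<epsilon>" using Pos_square[OF w] by blast
qed

section \<open>Positivity of \<open>x' * x\<close>\<close>

lemma nm_square_eq: assumes "adj x x'" shows "nm (x' * x) = (nm x)\<^sup>2"
  using nm_star[OF assms] nm_mult[OF adj_sym[OF assms] assms] nm_adj[OF assms] by (simp add: power2_eq_square)

text \<open>With \<open>N = \<parallel>y\<parallel>\<^sup>2\<close>, positivity of \<open>yy'\<close> (up to \<open>e\<close>) gives \<open>\<parallel>N - yy'\<parallel> \<le> N + e\<close>, so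
  \<open>y'(N - yy')y = Nb - b\<^sup>2\<close> with \<open>b = y'y\<close> has norm about \<open>N\<^sup>2\<close>. As \<open>- b\<close> is positive of norm
  \<open>N\<close>, it would have norm about \<open>2N\<^sup>2\<close>.\<close>

lemma nm_small_of_negative_square:
  assumes y: "adj y y'" and e: "e \<ge> 0" and P: "Pos (rl e - y' * y)"
  shows "(nm y)\<^sup>2 \<le> 6 * e"
proof -
  define N where "N = (nm y)\<^sup>2"
  define a where "a = y * y'"
  define b where "b = y' * y"
  note ys = adj_sym[OF y]
  have aa: "adj a a" and ba: "adj b b" unfolding a_def b_def by (intro adj_mult y ys)+
  have N0: "N \<ge> 0" by (simp add: N_def)
  have nb: "nm b = N" unfolding b_def N_def by (rule nm_square_eq[OF y])
  have na: "nm a = N" unfolding a_def N_def using nm_square_eq[OF ys] nm_adj[OF y] by simp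
  \<comment> \<open>Up to factors, \<open>y + y'\<close> and \<open>sc \<i> * (y - y')\<close> are
    the real and imaginary parts of \<open>y\<close>. Their squares add up to
    \<open>2 (yy' + y'y)\<close>, so near-positivity of \<open>- y'y\<close> passes to
    \<open>yy'\<close>.\<close>
  have u: "adj (y + y') (y + y')" using adj_add[OF y ys] by (simp add: add.commute)
  have w: "adj (sc \<i> * (y - y')) (sc \<i> * (y - y'))"
    using adj_mult[OF adj_sc[of \<i>] adj_diff[OF y ys]] sc_comm[OF y] sc_comm[OF ys]
    by (simp add: sc_minus algebra_simps)
  have ii: "sc \<i> * sc \<i> = - 1" using sc_mult[of \<i> \<i>] sc_minus[of 1] sc_1 by simp
  have "sc \<i> * (y - y') * (sc \<i> * (y - y')) = (sc \<i> * sc \<i>) * ((y - y') * (y - y'))"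
    using sc_left_comm[OF adj_diff[OF y ys]] by (simp add: mult.assoc)
  hence ww: "sc \<i> * (y - y') * (sc \<i> * (y - y')) = - ((y - y') * (y - y'))" unfolding ii by simp
  have "Pos ((y + y') * (y + y') + sc \<i> * (y - y') * (sc \<i> * (y - y')))"
    by (intro Pos_add Pos_square u w)
  also have "(y + y') * (y + y') + sc \<i> * (y - y') * (sc \<i> * (y - y')) = rl 2 * (a + b)"
    unfolding ww a_def b_def rl_2 by (simp add: algebra_simps)
  finally have "Pos (rl (1/2) * (rl 2 * (a + b)))" by (rule Pos_scale) simp
  also have "rl (1/2) * (rl 2 * (a + b)) = a + b"
    by (rule rl_half)
  finally have "Pos ((a + b) + (rl e - b))" using P unfolding b_def by (rule Pos_add)
  hence Pa: "Pos (rl e + a)" by (simp add: algebra_simps)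
  have "Pos (rl N - a)" using Pos_rl_diff[OF aa] na by simp
  hence "Pos (rl (N + e) - (rl e + a))" by (simp add: rl_add)
  hence 1: "nm (rl e + a - rl ((N + e) / 2)) \<le> (N + e) / 2"
    using Pos_bound[OF Pa] N0 e by simp
  have Na: "nm (rl N - a) \<le> N + e"
  proof -
    define m where "m = (N + e) / 2"
    have "rl N + rl e = rl m + rl m" unfolding m_def by (simp flip: rl_add)
    hence eq: "rl N - a = rl m - (rl e + a - rl m)" by (simp add: algebra_simps)
    have "nm (rl N - a) \<le> nm (rl m) + nm (rl e + a - rl m)"
      unfolding eq by (rule nm_diff[OF adj_rl adj_diff[OF adj_add[OF adj_rl aa] adj_rl]])
    also have "\<dots> \<le> m + m"
      using nm_rl[of m] 1 N0 e unfolding m_def[symmetric] by (simp add: m_def)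
    finally show ?thesis by (simp add: m_def)
  qed
  have aN: "adj (rl N - a) (rl N - a)" by (intro adjs aa)
  have "nm (y' * ((rl N - a) * y)) \<le> nm y * (nm (rl N - a) * nm y)"
    using nm_mult[OF ys adj_mult[OF aN y]] nm_mult[OF aN y] nm_adj[OF y]
    by (smt (verit) mult_left_mono nm_nonneg)
  also have "\<dots> = N * nm (rl N - a)" unfolding N_def by (simp add: power2_eq_square)
  also have "\<dots> \<le> N * (N + e)" using Na N0 by (rule mult_left_mono)
  finally have "nm (y' * ((rl N - a) * y)) \<le> N * (N + e)" .
  moreover have "y' * ((rl N - a) * y) = rl N * b - b * b"
    unfolding a_def b_def using rl_left_comm[OF ys] by (simp add: algebra_simps)
  ultimately have bb: "nm (rl N * b - b * b) \<le> N * (N + e)" by simp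
  define v where "v = rl (N / 2) - b"
  have v: "adj v v" unfolding v_def by (intro adjs ba)
  have "v * v = rl (N / 2 * (N / 2)) - (rl N * b - b * b)"
    unfolding v_def rl_halves[of N] rl_mult using rl_comm[OF ba] by (simp add: algebra_simps)
  moreover have "nm (rl (N / 2 * (N / 2)) - (rl N * b - b * b)) \<le> nm (rl (N / 2 * (N / 2))) + nm (rl N * b - b * b)"
    by (rule nm_diff[OF adj_rl adj_diff[OF adj_scale[OF ba] adj_mult[OF ba ba]]])
  ultimately have "nm (v * v) \<le> N / 2 * (N / 2) + N * (N + e)"
    using bb nm_rl[of "N / 2 * (N / 2)"] by simp
  hence "(nm v)\<^sup>2 \<le> N / 2 * (N / 2) + N * (N + e)" using nm_sa_square[OF v] by simp
  \<comment> \<open>\<open>9/8\<close> lies just above the square root of \<open>5/4\<close>, the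
    coefficient of \<open>N^2\<close> on the left. What matters later is
    \<open>9/8 + 1/2 < 2\<close>, so that \<open>N\<close> can be absorbed.\<close>
  also have "\<dots> \<le> (9/8 * N + e)\<^sup>2"
  proof -
    have "(9/8 * N + e)\<^sup>2 = N / 2 * (N / 2) + N * (N + e) + (N * N / 64 + 5/4 * (N * e) + e * e)"
      by (simp add: power2_eq_square algebra_simps)
    moreover have "N * N / 64 + 5/4 * (N * e) + e * e \<ge> 0" using N0 e by (intro add_nonneg_nonneg) simp_all
    ultimately show ?thesis by linarith
  qed
  finally have nv: "nm v \<le> 9/8 * N + e" by (rule power2_le_imp_le) (use N0 e in simp)
  have "Pos (rl N - (- b))" using Pos_rl_diff[OF adj_uminus[OF ba]] nb nm_minus[OF ba] by simp
  hence "Pos (rl (N + e) - (rl e - b))" by (simp add: rl_add)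
  hence "nm (rl e - b - rl ((N + e) / 2)) \<le> (N + e) / 2"
    using Pos_bound[of "rl e - b" "N + e"] P N0 e unfolding b_def by simp
  moreover define z where "z = rl e - b - rl ((N + e) / 2)"
  ultimately have nz: "nm z \<le> (N + e) / 2" by simp
  have z: "adj z z" unfolding z_def by (intro adjs ba)
  \<comment> \<open>\<open>v\<close> is \<open>- b\<close> shifted by \<open>N/2\<close> and
    \<open>z\<close> is \<open>- b\<close> shifted by about \<open>- N/2\<close>; in the sum the
    shifts cancel up to \<open>e/2\<close>.\<close>
  have "v + z = rl 2 * (- b) + rl (N / 2 + e - (N + e) / 2)"
    unfolding v_def z_def rl_2 by (simp add: rl_add rl_diff algebra_simps)
  hence "rl 2 * (- b) = v + z - rl (e / 2)" by (simp add: field_simps)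
  moreover have "nm (v + z - rl (e / 2)) \<le> nm v + nm z + nm (rl (e / 2))"
    using nm_diff[OF adj_add[OF v z] adj_rl[of "e / 2"]] nm_triangle[OF v z] by simp
  moreover have "nm (rl 2 * (- b)) = 2 * N" using nm_scale[OF adj_uminus[OF ba], of 2] nm_minus[OF ba] nb by simp
  ultimately have "2 * N \<le> nm v + nm z + nm (rl (e / 2))" by simp
  also have "\<dots> \<le> 9/8 * N + e + (N + e) / 2 + e / 2"
    using nm_rl[of "e / 2"] e by (intro add_mono nv nz) simp
  finally have "2 * N \<le> 9/8 * N + e + (N + e) / 2 + e / 2" .
  hence "N \<le> 6 * e" using e by (simp add: field_simps)
  thus ?thesis by (simp add: N_def)
qed

text \<open>Apply the previous lemma to \<open>y = xg\<close>, where \<open>g = s - h\<close> and \<open>s\<close> approximates \<open>\<bar>h\<bar>\<close>, so that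
  \<open>g\<close> is about twice the negative part of \<open>h\<close>.\<close>

theorem Pos_star_mult:
  assumes x: "adj x x'"
  shows "Pos (x' * x)"
proof (rule Pos_limit)
  define h where "h = x' * x"
  have h: "adj h h" unfolding h_def by (intro adj_mult x adj_sym[OF x])
  thus "adj (x' * x) (x' * x)" by (simp add: h_def)
  fix \<delta> :: real assume d: "\<delta> > 0"
  define G where "G = 2 * nm h + 1"
  have G: "G > 0" using nm_nonneg[of h] by (simp add: G_def)
  \<comment> \<open>\<open>nm (g^3)\<close> will be bounded by \<open>13 \<epsilon> G\<close>: one
    \<open>\<epsilon> G\<close> from \<open>r\<close> and six from each of two copies of
    \<open>h g^2\<close>. The cap \<open>1\<close> gives \<open>nm s \<le> nm h + 1\<close>.\<close>
  define \<epsilon> where "\<epsilon> = min 1 (\<delta> ^ 3 / (13 * G))"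
  have e: "\<epsilon> > 0" "\<epsilon> \<le> 1" using d G by (auto simp: \<epsilon>_def)
  have eG: "13 * (\<epsilon> * G) \<le> \<delta> ^ 3" using G by (simp add: \<epsilon>_def min_def field_simps)
  obtain s where s: "Pos s" "nm (s * s - h * h) \<le> \<epsilon>"
    and sc': "\<And>z z'. adj z z' \<Longrightarrow> z * (h * h) = (h * h) * z \<Longrightarrow> z * s = s * z"
    using Pos_sqrt[OF Pos_square[OF h] e(1)] by blast
  note sa = Pos_adj[OF s(1)]
  have hs: "h * s = s * h" using sc'[OF h] by (simp add: mult.assoc)
  define g where "g = s - h"
  define r where "r = (s * s - h * h) * g"
  have ga: "adj g g" unfolding g_def by (intro adjs sa h)
  have ha: "adj (s * s - h * h) (s * s - h * h)" by (intro adjs adj_mult sa h)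
  have hg: "h * g = g * h" and sg: "s * g = g * s" unfolding g_def using hs by (simp_all add: algebra_simps)
  have "(nm s)\<^sup>2 \<le> nm (s * s)" by (rule nm_sa_square[OF sa])
  also have "\<dots> \<le> nm (s * s - h * h) + nm (h * h)" using nm_triangle[OF ha adj_mult[OF h h]] by simp
  also have "\<dots> \<le> 1 + (nm h)\<^sup>2" using s e nm_mult[OF h h] by (simp add: power2_eq_square)
  also have "\<dots> \<le> (nm h + 1)\<^sup>2" using nm_nonneg[of h] by (simp add: power2_eq_square algebra_simps)
  finally have "nm s \<le> nm h + 1" by (rule power2_le_imp_le) (use nm_nonneg[of h] in simp)
  hence gG: "nm g \<le> G" unfolding g_def G_def using nm_diff[OF sa h] by simp
  \<comment> \<open>Since \<open>r\<close> is small, \<open>h g^2\<close> is nearly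
    \<open>- s g^2\<close>, hence nearly negative; but \<open>h g^2\<close> is also
    \<open>(xg)'(xg)\<close>, and so it must be small.\<close>
  have r_eq: "r = s * (g * g) + h * (g * g)"
  proof -
    have "s * s - h * h = (s + h) * g" unfolding g_def using hs by (simp add: algebra_simps)
    thus ?thesis unfolding r_def by (simp only: distrib_right mult.assoc)
  qed
  have sgg: "Pos (s * (g * g))" by (rule Pos_mult_square[OF s(1) ga sg])
  have hgg_comm: "h * (g * g) = g * g * h" by (metis hg mult.assoc)
  have hgg: "adj (h * (g * g)) (h * (g * g))" using adj_mult[OF h adj_mult[OF ga ga]] hgg_comm by simp
  have ra: "adj r r" unfolding r_eq by (rule adj_add[OF Pos_adj[OF sgg] hgg])
  have nr: "nm r \<le> \<epsilon> * G"
    unfolding r_def using nm_mult[OF ha ga] mult_mono[OF s(2) gG] e nm_nonneg[of g] by linarith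
  have y: "adj (x * g) (g * x')" by (rule adj_mult[OF x ga])
  have yy: "g * x' * (x * g) = h * (g * g)"
    unfolding h_def by (metis hg h_def mult.assoc)
  have "Pos (rl (\<epsilon> * G) - r + s * (g * g))"
    by (intro Pos_add sgg Pos_rl_diff ra nr)
  hence "Pos (rl (\<epsilon> * G) - g * x' * (x * g))" unfolding yy r_eq by (simp add: algebra_simps)
  hence "(nm (x * g))\<^sup>2 \<le> 6 * (\<epsilon> * G)"
    using nm_small_of_negative_square[OF y] e G by simp
  hence nh: "nm (h * (g * g)) \<le> 6 * (\<epsilon> * G)" using nm_square_eq[OF y] yy by simp
  have "g * (g * g) = r - (h * (g * g) + h * (g * g))"
    unfolding r_eq by (simp add: g_def algebra_simps)
  moreover have "nm (r - (h * (g * g) + h * (g * g))) \<le> nm r + (nm (h * (g * g)) + nm (h * (g * g)))"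
    using nm_diff[OF ra adj_add[OF hgg hgg]] nm_triangle[OF hgg hgg] by simp
  ultimately have g3: "nm (g * (g * g)) \<le> \<delta> ^ 3" using nr nh eG by simp
  \<comment> \<open>Two uses of the C*-inequality give
    \<open>(nm g)^4 \<le> nm (g^4) \<le> nm g * nm (g^3)\<close>, so a small cube forces a small
    \<open>g\<close>.\<close>
  have "nm g \<le> \<delta>"
  proof (cases "nm g = 0")
    case False
    hence g0: "nm g > 0" using nm_nonneg[of g] by simp
    have gga: "adj (g * g) (g * g)" and ggga: "adj (g * (g * g)) (g * (g * g))"
      using adj_mult[OF ga ga] adj_mult[OF ga adj_mult[OF ga ga]] by (simp_all add: mult.assoc)
    have "((nm g)\<^sup>2)\<^sup>2 \<le> (nm (g * g))\<^sup>2" using nm_sa_square[OF ga] by (intro power_mono) auto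
    also have "\<dots> \<le> nm (g * g * (g * g))" by (rule nm_sa_square[OF gga])
    also have "g * g * (g * g) = g * (g * (g * g))" by (simp add: mult.assoc)
    also have "nm \<dots> \<le> nm g * nm (g * (g * g))" by (rule nm_mult[OF ga ggga])
    also have "\<dots> \<le> nm g * \<delta> ^ 3" using g3 g0 by simp
    finally have "nm g * (nm g) ^ 3 \<le> nm g * \<delta> ^ 3" by (simp add: power2_eq_square power3_eq_cube mult.assoc)
    hence "(nm g) ^ 3 \<le> \<delta> ^ 3" using g0 by (simp only: mult_le_cancel_left_pos)
    thus ?thesis using power_mono_iff[of "nm g" \<delta> 3] g0 d by (simp only: less_imp_le zero_less_numeral)
  qed (use d in simp)
  moreover have "x' * x - s = - g" by (simp add: g_def h_def)
  ultimately have "nm (x' * x - s) \<le> \<delta>" using nm_minus[OF ga] by simp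
  thus "\<exists>l. Pos l \<and> nm (x' * x - l) \<le> \<delta>" using s(1) by blast
qed

end

section \<open>The operator algebra of a C*-seminorm\<close>

text \<open>All additive maps are taken, so that the ring structure lives on a whole type; complex
  linearity and boundedness enter through \<open>op_adj\<close>.\<close>

typedef (overloaded) ('v::ab_group_add) endo = "{f :: 'v \<Rightarrow> 'v. \<forall>x y. f (x + y) = f x + f y}"
  morphisms app Endo
  by (rule exI[of _ "\<lambda>x. x"]) simp

lemma app_add_arg: "app u (x + y) = app u x + app u y"
  using app[of u] by simp

lemma app_Endo: "(\<And>x y. f (x + y) = f x + f y) \<Longrightarrow> app (Endo f) = f"
  by (rule Endo_inverse) simp

lemma endo_eqI: "(\<And>x. app u x = app v x) \<Longrightarrow> u = v"
  by (metis app_inverse ext)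

instantiation endo :: (ab_group_add) ring
begin

definition "0 = Endo (\<lambda>_. 0)"
definition "u + v = Endo (\<lambda>x. app u x + app v x)"
definition "- u = Endo (\<lambda>x. - app u x)"
definition "u - v = Endo (\<lambda>x. app u x - app v x)"
definition "u * v = Endo (\<lambda>x. app u (app v x))"

lemma app_simps [simp]:
  "app 0 x = 0" "app (u + v) x = app u x + app v x" "app (- u) x = - app u x"
  "app (u - v) x = app u x - app v x" "app (u * v) x = app u (app v x)"
  unfolding zero_endo_def plus_endo_def uminus_endo_def minus_endo_def times_endo_def
  by (subst app_Endo; simp add: app_add_arg algebra_simps)+

instance
  by standard (rule endo_eqI; simp add: app_add_arg algebra_simps)+

end


text \<open>Not an instance of \<open>ring_1\<close>, which would require \<open>0 \<noteq> 1\<close>.\<close>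

instantiation endo :: (ab_group_add) monoid_mult
begin

definition "1 = Endo (\<lambda>x. x)"

lemma app_one [simp]: "app 1 x = x"
  by (simp add: one_endo_def app_Endo)

instance
  by standard (rule endo_eqI; simp)+

end

section \<open>Seminorm calculus on the algebra\<close>

locale seminormed_procstar =
  fixes A :: "('a::ring) procstar" and p :: "'a \<Rightarrow> real"
  assumes A: "pro_cstar_algebra A" and p: "p \<in> seminorms A"
begin

lemma smul_add: "smul A c (x + y) = smul A c x + smul A c y"
  and smul_add_left: "smul A (c + d) x = smul A c x + smul A d x"
  and smul_smul: "smul A c (smul A d x) = smul A (c * d) x"
  and smul_1 [simp]: "smul A 1 x = x"
  and smul_mult_left: "smul A c x * y = smul A c (x * y)"
  and smul_mult_right: "x * smul A c y = smul A c (x * y)"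
  and star_star [simp]: "star A (star A x) = x"
  and star_add: "star A (x + y) = star A x + star A y"
  and star_mult: "star A (x * y) = star A y * star A x"
  and star_smul: "star A (smul A c x) = smul A (cnj c) (star A x)"
  using A unfolding pro_cstar_algebra_def by metis+

lemma cstar_p: "cstar_seminorm A p"
proof -
  have "\<forall>q\<in>seminorms A. cstar_seminorm A q" using A unfolding pro_cstar_algebra_def by (elim conjE)
  thus ?thesis using p by blast
qed

lemma p_add: "p (x + y) \<le> p x + p y"
  and p_smul: "p (smul A c x) = cmod c * p x"
  and p_mult: "p (x * y) \<le> p x * p y"
  and p_star_mult: "p (star A x * x) = (p x)\<^sup>2"
  using cstar_p unfolding cstar_seminorm_def by blast+

lemma smul_0_left [simp]: "smul A 0 x = 0"
  using smul_add_left[of 0 0 x] by simp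

lemma smul_0 [simp]: "smul A c 0 = 0"
  using smul_add[of c 0 0] by simp

lemma smul_minus_left: "smul A (- c) x = - smul A c x"
  using smul_add_left[of c "- c" x] by (simp add: add_eq_0_iff)

lemma smul_minus: "smul A c (- x) = - smul A c x"
  using smul_add[of c x "- x"] by (simp add: add_eq_0_iff)

lemma smul_diff: "smul A c (x - y) = smul A c x - smul A c y"
  using smul_add[of c x "- y"] by (simp add: smul_minus)

lemma star_0 [simp]: "star A 0 = 0"
  using star_add[of 0 0] by simp

lemma star_minus: "star A (- x) = - star A x"
  using star_add[of x "- x"] by (simp add: add_eq_0_iff)

lemma star_diff: "star A (x - y) = star A x - star A y"
  using star_add[of x "- y"] by (simp add: star_minus)

lemma p_0 [simp]: "p 0 = 0"
  using p_smul[of 0 0] by simp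

lemma p_minus [simp]: "p (- x) = p x"
  using p_smul[of "-1" x] by (simp add: smul_minus_left)

lemma p_nonneg [simp]: "p x \<ge> 0"
  using p_add[of x "- x"] by simp

lemma p_diff: "p (x - y) \<le> p x + p y"
  using p_add[of x "- y"] by simp

lemma p_star [simp]: "p (star A x) = p x"
proof -
  have "p y \<le> p (star A y)" for y
  proof (cases "p y = 0")
    case False
    have "p y * p y \<le> p (star A y) * p y"
      using p_star_mult[of y] p_mult[of "star A y" y] by (simp add: power2_eq_square)
    thus ?thesis using False p_nonneg[of y] by simp
  qed simp
  from this[of x] this[of "star A x"] show ?thesis by simp
qed

lemma p_mult_star: "p (x * star A x) = (p x)\<^sup>2"
  using p_star_mult[of "star A x"] by simp

section \<open>Bounded adjointable operators\<close>

definition p_bounded :: "'a endo \<Rightarrow> bool" where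
  "p_bounded u \<longleftrightarrow> (\<exists>M\<ge>0. \<forall>x. p (app u x) \<le> M * p x)"

text \<open>Adjointness for the algebra-valued form \<open>star A x * y\<close> on \<open>A\<close>
  itself.\<close>

definition op_adj :: "'a endo \<Rightarrow> 'a endo \<Rightarrow> bool" where
  "op_adj u u' \<longleftrightarrow> p_bounded u \<and> p_bounded u' \<and>
     (\<forall>c x. app u (smul A c x) = smul A c (app u x)) \<and>
     (\<forall>c x. app u' (smul A c x) = smul A c (app u' x)) \<and>
     (\<forall>x y. star A (app u x) * y = star A x * app u' y)"

text \<open>Points with \<open>p x = 0\<close> contribute \<open>0\<close> through division by zero;
  for a \<open>p_bounded\<close> operator nothing is lost, since \<open>p (app u x)\<close> vanishes
  there too. The \<open>max\<close> keeps the value nonnegative for unbounded operators, where the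
  supremum is unspecified.\<close>

definition op_norm :: "'a endo \<Rightarrow> real" where
  "op_norm u = max 0 (SUP x. p (app u x) / p x)"

definition op_sc :: "complex \<Rightarrow> 'a endo" where
  "op_sc c = Endo (smul A c)"

definition op_mult :: "'a \<Rightarrow> 'a endo" where
  "op_mult a = Endo (\<lambda>x. a * x)"

lemma app_op_sc [simp]: "app (op_sc c) x = smul A c x"
  unfolding op_sc_def by (subst app_Endo) (simp_all add: smul_add)

lemma app_op_mult [simp]: "app (op_mult a) x = a * x"
  unfolding op_mult_def by (subst app_Endo) (simp_all add: distrib_left)

lemma p_ratio_le: "M \<ge> 0 \<Longrightarrow> p y \<le> M * p x \<Longrightarrow> p y / p x \<le> M"
  using p_nonneg[of x] by (cases "p x = 0") (auto simp: pos_divide_le_eq less_le)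

lemma op_norm_le:
  assumes "M \<ge> 0" "\<And>x. p (app u x) \<le> M * p x"
  shows "op_norm u \<le> M"
proof -
  have "p (app u x) / p x \<le> M" for x
    using assms by (intro p_ratio_le)
  hence "(SUP x. p (app u x) / p x) \<le> M" by (intro cSUP_least) auto
  thus ?thesis using assms(1) by (simp add: op_norm_def)
qed

lemma op_norm_bound:
  assumes "p_bounded u" shows "p (app u x) \<le> op_norm u * p x"
proof -
  obtain M where M: "M \<ge> 0" "\<And>x. p (app u x) \<le> M * p x" using assms unfolding p_bounded_def by blast
  show ?thesis
  proof (cases "p x = 0")
    case True
    thus ?thesis using M(2)[of x] by simp
  next
    case False
    have "p (app u x) / p x \<le> M" for x
      using M by (intro p_ratio_le)
    hence "bdd_above (range (\<lambda>x. p (app u x) / p x))" by (intro bdd_aboveI[of _ M]) auto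
    hence "p (app u x) / p x \<le> (SUP x. p (app u x) / p x)" by (intro cSUP_upper) auto
    hence "p (app u x) / p x \<le> op_norm u" by (simp add: op_norm_def)
    thus ?thesis using False p_nonneg[of x] by (simp add: field_simps)
  qed
qed

lemma op_norm_nonneg: "op_norm u \<ge> 0"
  by (simp add: op_norm_def)

lemma p_boundedI: "M \<ge> 0 \<Longrightarrow> (\<And>x. p (app u x) \<le> M * p x) \<Longrightarrow> p_bounded u"
  unfolding p_bounded_def by blast

lemma add_bound:
  assumes "p_bounded u" "p_bounded v"
  shows "p (app (u + v) x) \<le> (op_norm u + op_norm v) * p x"
  using op_norm_bound[OF assms(1), of x] op_norm_bound[OF assms(2), of x] p_add[of "app u x" "app v x"]
  by (simp add: algebra_simps)

lemma mult_bound: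
  assumes "p_bounded u" "p_bounded v"
  shows "p (app (u * v) x) \<le> (op_norm u * op_norm v) * p x"
  using op_norm_bound[OF assms(1), of "app v x"]
    mult_left_mono[OF op_norm_bound[OF assms(2), of x] op_norm_nonneg[of u]]
  by (simp add: mult.assoc)

lemma p_bounded_add: "p_bounded u \<Longrightarrow> p_bounded v \<Longrightarrow> p_bounded (u + v)"
  by (rule p_boundedI[OF _ add_bound]) (auto simp: op_norm_nonneg)

lemma p_bounded_mult: "p_bounded u \<Longrightarrow> p_bounded v \<Longrightarrow> p_bounded (u * v)"
  by (rule p_boundedI[OF _ mult_bound]) (auto simp: op_norm_nonneg)

lemma p_bounded_op_sc: "p_bounded (op_sc c)"
  by (rule p_boundedI[of "cmod c"]) (auto simp: p_smul)

lemma op_adj_bounded: "op_adj u v \<Longrightarrow> p_bounded u"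
  by (simp add: op_adj_def)

lemma op_adj_smul: "op_adj u v \<Longrightarrow> app u (smul A c x) = smul A c (app u x)"
  by (simp add: op_adj_def)

lemma op_adj_sym: assumes "op_adj u v" shows "op_adj v u"
proof -
  have "star A (app v x) * y = star A x * app u y" for x y
  proof -
    have "star A (app v x) * y = star A (star A y * app v x)" by (simp add: star_mult)
    also have "star A y * app v x = star A (app u y) * x" using assms by (simp add: op_adj_def)
    also have "star A (star A (app u y) * x) = star A x * app u y" by (simp add: star_mult)
    finally show ?thesis .
  qed
  thus ?thesis using assms by (simp add: op_adj_def)
qed

text \<open>The C*-identity of \<open>p\<close> and adjointness turn \<open>(p (app u x))^2\<close>
  into \<open>p (star A x * app (u' * u) x)\<close>, which is at most
  \<open>op_norm (u' * u) * (p x)^2\<close>.\<close>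

lemma op_norm_star:
  assumes u: "op_adj u u'"
  shows "(op_norm u)\<^sup>2 \<le> op_norm (u' * u)"
proof -
  have b: "p_bounded (u' * u)"
    by (intro p_bounded_mult op_adj_bounded[OF u] op_adj_bounded[OF op_adj_sym[OF u]])
  have "p (app u x) \<le> sqrt (op_norm (u' * u)) * p x" for x
  proof (rule power2_le_imp_le)
    have "(p (app u x))\<^sup>2 = p (star A (app u x) * app u x)" by (simp add: p_star_mult)
    also have "star A (app u x) * app u x = star A x * app (u' * u) x" using u by (simp add: op_adj_def)
    also have "p \<dots> \<le> p x * p (app (u' * u) x)" using p_mult[of "star A x"] by simp
    also have "\<dots> \<le> p x * (op_norm (u' * u) * p x)"
      by (intro mult_left_mono op_norm_bound[OF b]) simp
    finally show "(p (app u x))\<^sup>2 \<le> (sqrt (op_norm (u' * u)) * p x)\<^sup>2"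
      using op_norm_nonneg[of "u' * u"] by (simp add: power_mult_distrib power2_eq_square mult_ac)
  qed (simp add: op_norm_nonneg)
  hence "op_norm u \<le> sqrt (op_norm (u' * u))" by (intro op_norm_le) (auto simp: op_norm_nonneg)
  hence "(op_norm u)\<^sup>2 \<le> (sqrt (op_norm (u' * u)))\<^sup>2" by (intro power_mono op_norm_nonneg)
  thus ?thesis by (simp add: op_norm_nonneg)
qed

lemma op_norm_sc:
  assumes u: "op_adj u u'" shows "op_norm (op_sc c * u) = cmod c * op_norm u"
proof (rule antisym)
  note b = op_adj_bounded[OF u]
  show "op_norm (op_sc c * u) \<le> cmod c * op_norm u"
    using op_norm_bound[OF b]
    by (intro op_norm_le) (auto simp: op_norm_nonneg p_smul mult.assoc intro!: mult_left_mono)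
  show "cmod c * op_norm u \<le> op_norm (op_sc c * u)"
  proof (cases "c = 0")
    case False
    have b': "p_bounded (op_sc c * u)" by (intro p_bounded_mult p_bounded_op_sc b)
    have "p (app u x) \<le> op_norm (op_sc c * u) / cmod c * p x" for x
      using op_norm_bound[OF b', of x] False by (simp add: p_smul field_simps)
    hence "op_norm u \<le> op_norm (op_sc c * u) / cmod c" by (intro op_norm_le) (auto simp: op_norm_nonneg)
    thus ?thesis using False by (simp add: field_simps)
  qed (simp add: op_norm_nonneg)
qed

sublocale op: cstar_unital op_adj op_sc op_norm
proof
  fix x x' y y' :: "'a endo" and a b c :: complex
  show "op_adj x y \<Longrightarrow> op_adj y x" by (rule op_adj_sym)
  show "op_adj x x' \<Longrightarrow> op_adj y y' \<Longrightarrow> op_adj (x + y) (x' + y')"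
    unfolding op_adj_def by (auto simp: p_bounded_add smul_add star_add algebra_simps)
  show "op_adj x x' \<Longrightarrow> op_adj y y' \<Longrightarrow> op_adj (x * y) (y' * x')"
    unfolding op_adj_def by (auto simp: p_bounded_mult)
  show "op_adj (op_sc c) (op_sc (cnj c))"
    unfolding op_adj_def
    by (auto simp: p_bounded_op_sc smul_smul mult.commute star_smul smul_mult_left smul_mult_right)
  show "op_sc (a + b) = op_sc a + op_sc b" by (rule endo_eqI) (simp add: smul_add_left)
  show "op_sc (a * b) = op_sc a * op_sc b" by (rule endo_eqI) (simp add: smul_smul)
  show "op_sc 1 = 1" by (rule endo_eqI) simp
  show "op_adj x y \<Longrightarrow> x * op_sc c = op_sc c * x" by (rule endo_eqI) (simp add: op_adj_smul)
  show "op_adj x x' \<Longrightarrow> op_adj y y' \<Longrightarrow> op_norm (x + y) \<le> op_norm x + op_norm y"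
    by (rule op_norm_le) (auto simp del: app_simps intro!: add_bound op_adj_bounded add_nonneg_nonneg op_norm_nonneg)
  show "op_adj x x' \<Longrightarrow> op_adj y y' \<Longrightarrow> op_norm (x * y) \<le> op_norm x * op_norm y"
    by (rule op_norm_le) (auto simp del: app_simps intro!: mult_bound op_adj_bounded mult_nonneg_nonneg op_norm_nonneg)
  show "op_adj x x' \<Longrightarrow> op_norm (op_sc c * x) = cmod c * op_norm x" by (rule op_norm_sc)
  show "op_norm 1 \<le> 1" by (rule op_norm_le) auto
  show "op_norm x \<ge> 0" by (rule op_norm_nonneg)
  show "op_adj x x' \<Longrightarrow> (op_norm x)\<^sup>2 \<le> op_norm (x' * x)" by (rule op_norm_star)
qed

section \<open>Left multiplications and the positive cone\<close>

lemma op_mult_add: "op_mult (a + b) = op_mult a + op_mult b"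
  by (rule endo_eqI) (simp add: distrib_right)

lemma op_mult_mult: "op_mult (a * b) = op_mult a * op_mult b"
  by (rule endo_eqI) (simp add: mult.assoc)

lemma p_bounded_op_mult: "p_bounded (op_mult a)"
  by (rule p_boundedI[of "p a"]) (auto simp: p_mult)

lemma op_adj_op_mult: "op_adj (op_mult a) (op_mult (star A a))"
  unfolding op_adj_def
  by (auto simp: p_bounded_op_mult smul_mult_right star_mult mult.assoc)

text \<open>The lower bound comes from testing on \<open>star A a\<close>. Thus norm inequalities
  proved in the unital operator algebra return to \<open>A\<close>, which may have no unit.\<close>

lemma op_norm_op_mult: "op_norm (op_mult a) = p a"
proof (rule antisym)
  show "op_norm (op_mult a) \<le> p a" by (rule op_norm_le) (auto simp: p_mult)
  show "p a \<le> op_norm (op_mult a)"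
  proof (cases "p a = 0")
    case False
    have "p a * p a \<le> op_norm (op_mult a) * p a"
      using op_norm_bound[OF p_bounded_op_mult, of a "star A a"] p_mult_star[of a]
      by (simp add: power2_eq_square)
    thus ?thesis using False p_nonneg[of a] by simp
  qed (simp add: op_norm_nonneg)
qed

text \<open>Closing under sums by definition avoids having to find a square root in \<open>A\<close>
  for a sum.\<close>

inductive_set cone :: "'a set" where
  cone_square: "star A c * c \<in> cone"
| cone_add: "x \<in> cone \<Longrightarrow> y \<in> cone \<Longrightarrow> x + y \<in> cone"

lemma Pos_cone: "x \<in> cone \<Longrightarrow> op.Pos (op_mult x)"
proof (induction rule: cone.induct)
  case (cone_square c)
  show ?case unfolding op_mult_mult by (rule op.Pos_star_mult[OF op_adj_op_mult])
qed (simp add: op_mult_add op.Pos_add)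

theorem p_mono_cone: "x \<in> cone \<Longrightarrow> y \<in> cone \<Longrightarrow> p x \<le> p (x + y)"
  using op.nm_mono_Pos[OF Pos_cone Pos_cone, of x y]
  by (simp add: op_norm_op_mult flip: op_mult_add)

end

section \<open>Hilbert modules\<close>

context seminormed_procstar
begin

section \<open>The order modulo \<open>p\<close> and contractions of forms\<close>

abbreviation rs :: "real \<Rightarrow> 'a \<Rightarrow> 'a" where
  "rs c \<equiv> smul A (complex_of_real c)"

lemma p_rs: "p (rs c x) = \<bar>c\<bar> * p x"
  by (simp add: p_smul)

lemma rs_half: "rs (1/2) x + rs (1/2) x = x"
  using smul_add_left[of "1/2" "1/2" x] by simp

lemma cone_0: "0 \<in> cone"
  using cone_square[of 0] by simp

lemma cone_rs: assumes "x \<in> cone" "c \<ge> 0" shows "rs c x \<in> cone"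
  using assms(1)
proof induction
  case (cone_square d)
  have "rs c (star A d * d) = star A (rs (sqrt c) d) * rs (sqrt c) d"
    using assms(2) by (simp add: star_smul smul_mult_left smul_mult_right smul_smul flip: of_real_mult)
  thus ?case using cone.cone_square by metis
qed (simp add: smul_add cone.cone_add)

lemma positive_cone: "positive A x \<Longrightarrow> x \<in> cone"
  unfolding positive_def using cone_square by blast

text \<open>The cone is replaced by its closure for \<open>p\<close>, so that inequalities obtained
  only as limits, such as \<open>form_contraction\<close>, can be stated and added.\<close>

definition le :: "'a \<Rightarrow> 'a \<Rightarrow> bool" (infix "\<preceq>" 50) where
  "x \<preceq> y \<longleftrightarrow> (\<forall>\<epsilon>>0. \<exists>q\<in>cone. p (y - x - q) \<le> \<epsilon>)"

lemma le_cone: "y - x \<in> cone \<Longrightarrow> x \<preceq> y"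
  unfolding le_def by (force intro: bexI[of _ "y - x"])

lemma le_cong: "x \<preceq> y \<Longrightarrow> y - x = y' - x' \<Longrightarrow> x' \<preceq> y'"
  unfolding le_def by simp

lemma le_add: assumes "x \<preceq> y" "z \<preceq> w" shows "x + z \<preceq> y + w"
  unfolding le_def
proof (intro allI impI)
  fix \<epsilon> :: real assume "\<epsilon> > 0"
  hence "\<epsilon> / 2 > 0" by simp
  then obtain q r where q: "q \<in> cone" "p (y - x - q) \<le> \<epsilon> / 2" and r: "r \<in> cone" "p (w - z - r) \<le> \<epsilon> / 2"
    using assms unfolding le_def by meson
  have "y + w - (x + z) - (q + r) = (y - x - q) + (w - z - r)" by simp
  hence "p (y + w - (x + z) - (q + r)) \<le> p (y - x - q) + p (w - z - r)"
    by (simp only: p_add)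
  also have "\<dots> \<le> \<epsilon> / 2 + \<epsilon> / 2" by (rule add_mono[OF q(2) r(2)])
  finally have "p (y + w - (x + z) - (q + r)) \<le> \<epsilon>" by simp
  thus "\<exists>q\<in>cone. p (y + w - (x + z) - q) \<le> \<epsilon>" using cone_add q r by blast
qed

lemma le_refl: "x \<preceq> x"
  by (rule le_cone) (simp add: cone_0)

lemma le_trans: assumes "x \<preceq> y" "y \<preceq> z" shows "x \<preceq> z"
proof -
  have "x + y \<preceq> y + z" by (rule le_add[OF assms])
  thus ?thesis by (rule le_cong) simp
qed

lemma le_rs: assumes "x \<preceq> y" "c > 0" shows "rs c x \<preceq> rs c y"
  unfolding le_def
proof (intro allI impI)
  fix \<epsilon> :: real assume "\<epsilon> > 0"
  hence "\<epsilon> / c > 0" using assms by simp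
  then obtain q where q: "q \<in> cone" "p (y - x - q) \<le> \<epsilon> / c" using assms unfolding le_def by meson
  have "p (rs c y - rs c x - rs c q) = c * p (y - x - q)"
    using assms(2) p_rs[of c "y - x - q"] by (simp add: smul_diff)
  also have "\<dots> \<le> \<epsilon>" using q assms(2) by (simp add: field_simps)
  finally show "\<exists>q\<in>cone. p (rs c y - rs c x - q) \<le> \<epsilon>" using cone_rs[OF q(1)] assms(2) by fastforce
qed

lemma p_mono: assumes x: "x \<in> cone" and le: "x \<preceq> y" shows "p x \<le> p y"
proof (rule field_le_epsilon)
  fix \<epsilon> :: real assume "\<epsilon> > 0"
  then obtain q where q: "q \<in> cone" "p (y - x - q) \<le> \<epsilon>" using le unfolding le_def by meson
  have "p x \<le> p (x + q)" by (rule p_mono_cone[OF x q(1)])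
  also have "x + q = y - (y - x - q)" by simp
  also have "p \<dots> \<le> p y + p (y - x - q)" by (rule p_diff)
  finally show "p x \<le> p y + \<epsilon>" using q by simp
qed

text \<open>Iterates the identity \<open>1 - S = (1 - S)\<^sup>2 / 2 + (1 - S\<^sup>2) / 2\<close>.\<close>

lemma form_contraction_approx:
  fixes B :: "'v::ab_group_add \<Rightarrow> 'v \<Rightarrow> 'a"
  assumes diff: "\<And>x y z. B (x - y) z = B x z - B y z" "\<And>x y z. B z (x - y) = B z x - B z y"
    and pos: "\<And>x. B x x \<in> cone"
    and sym: "\<And>x y. B (S x) y = B x (S y)"
    and bound: "\<And>n. p (B ((S ^^ n) u) u) \<le> M"
  shows "\<exists>q\<in>cone. p (B u u - B (S u) u - q) \<le> 2 * M / 2 ^ m"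
  using sym bound
proof (induction m arbitrary: S)
  case 0
  have "p (B u u - B (S u) u) \<le> p (B u u) + p (B (S u) u)" by (rule p_diff)
  thus ?case using 0(2)[of 0] 0(2)[of 1] cone_0 by force
next
  case (Suc m)
  \<comment> \<open>The hypotheses pass to \<open>S \<circ> S\<close>, whose powers are the even
    powers of \<open>S\<close>; averaging then halves the error.\<close>
  have "S \<circ> S = S ^^ 2" by (simp add: numeral_2_eq_2)
  hence "(S \<circ> S) ^^ n = S ^^ (2 * n)" for n by (simp only: funpow_mult)
  hence "p (B (((S \<circ> S) ^^ n) u) u) \<le> M" for n using Suc.prems(2)[of "2 * n"] by simp
  moreover have "B ((S \<circ> S) x) y = B x ((S \<circ> S) y)" for x y by (simp add: Suc.prems(1))
  ultimately have "\<exists>q\<in>cone. p (B u u - B ((S \<circ> S) u) u - q) \<le> 2 * M / 2 ^ m"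
    by (intro Suc.IH)
  then obtain q where q: "q \<in> cone" "p (B u u - B (S (S u)) u - q) \<le> 2 * M / 2 ^ m" by auto
  define r where "r = rs (1/2) (B (u - S u) (u - S u)) + rs (1/2) q"
  have r: "r \<in> cone" unfolding r_def by (intro cone_add cone_rs pos q) simp_all
  define P Q R where "P = rs (1/2) (B u u)" and "Q = rs (1/2) (B (S u) u)" and "R = rs (1/2) (B (S (S u)) u)"
  have halves: "B u u = P + P" "B (S u) u = Q + Q" unfolding P_def Q_def by (simp_all only: rs_half)
  have "B (u - S u) (u - S u) = B u u - B (S u) u - B (S u) u + B (S (S u)) u"
    using Suc.prems(1)[of u u] Suc.prems(1)[of "S u" u] by (simp add: diff)
  hence "r = P - Q - Q + R + rs (1/2) q"
    unfolding r_def P_def Q_def R_def by (simp only: smul_diff smul_add)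
  hence "B u u - B (S u) u - r = P - R - rs (1/2) q" unfolding halves by (simp add: algebra_simps)
  also have "\<dots> = rs (1/2) (B u u - B (S (S u)) u - q)" unfolding P_def R_def by (simp only: smul_diff)
  finally have "B u u - B (S u) u - r = rs (1/2) (B u u - B (S (S u)) u - q)" .
  hence "p (B u u - B (S u) u - r) = 1/2 * p (B u u - B (S (S u)) u - q)" using p_rs[of "1/2"] by simp
  thus ?case using q r by (intro bexI[of _ r]) auto
qed

text \<open>The error \<open>2 * M / 2 ^ m\<close> tends to \<open>0\<close>. The form is kept
  abstract because the lemma is used twice: on \<open>A\<close> itself to obtain Cauchy-Schwarz, and
  then on the module, where Cauchy-Schwarz supplies the bound \<open>M\<close>.\<close>

lemma form_contraction:
  fixes B :: "'v::ab_group_add \<Rightarrow> 'v \<Rightarrow> 'a"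
  assumes "\<And>x y z. B (x - y) z = B x z - B y z" "\<And>x y z. B z (x - y) = B z x - B z y"
    and "\<And>x. B x x \<in> cone"
    and "\<And>x y. B (S x) y = B x (S y)"
    and bound: "\<And>n. p (B ((S ^^ n) u) u) \<le> M"
  shows "B (S u) u \<preceq> B u u"
  unfolding le_def
proof (intro allI impI)
  fix \<epsilon> :: real assume e: "\<epsilon> > 0"
  have "(\<lambda>m. 2 * M * (1/2) ^ m) \<longlonglongrightarrow> 2 * M * 0"
    by (intro tendsto_mult tendsto_const LIMSEQ_power_zero) auto
  hence "\<forall>\<^sub>F m in sequentially. 2 * M * (1/2) ^ m < \<epsilon>" by (rule order_tendstoD) (use e in simp)
  then obtain m where "2 * M * (1/2) ^ m < \<epsilon>" by (auto simp: eventually_sequentially)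
  hence "2 * M / 2 ^ m < \<epsilon>" by (simp add: power_one_over field_simps)
  thus "\<exists>q\<in>cone. p (B u u - B (S u) u - q) \<le> \<epsilon>"
    using form_contraction_approx[where B = B and S = S and m = m, OF assms] by (meson less_imp_le order_trans)
qed

end

section \<open>Inner products and the Cauchy-Schwarz inequality\<close>

locale seminormed_hmodule = seminormed_procstar A p
  for A :: "('a::ring) procstar" and p :: "'a \<Rightarrow> real" +
  fixes X :: "('a, 'x::ab_group_add) hmodule"
  assumes X: "hilbert_module A X"
begin

abbreviation ip :: "'x \<Rightarrow> 'x \<Rightarrow> 'a" where "ip \<equiv> inner X"
abbreviation N :: "'x \<Rightarrow> real" where "N \<equiv> xnorm X p"
abbreviation xr :: "real \<Rightarrow> 'x \<Rightarrow> 'x" where "xr c \<equiv> xsmul X (complex_of_real c)"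

lemma ip_add: "ip (x + y) z = ip x z + ip y z"
  and ip_smul: "ip (xsmul X c x) z = smul A c (ip x z)"
  and ip_act: "ip (act X a x) z = a * ip x z"
  and ip_star: "star A (ip x y) = ip y x"
  and ip_pos: "positive A (ip x x)"
  using X unfolding hilbert_module_def by metis+

lemma ip_cone: "ip x x \<in> cone"
  using ip_pos positive_cone by blast

lemma ip_add_right: "ip z (x + y) = ip z x + ip z y"
  by (metis ip_add ip_star star_add)

lemma ip_smul_right: "ip z (xsmul X c x) = smul A (cnj c) (ip z x)"
  by (metis ip_smul ip_star star_smul)

lemma ip_act_right: "ip z (act X a x) = ip z x * star A a"
  by (metis ip_act ip_star star_mult)

lemma ip_diff: "ip (x - y) z = ip x z - ip y z"
  using ip_add[of "x - y" y z] by simp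

lemma ip_diff_right: "ip z (x - y) = ip z x - ip z y"
  using ip_add_right[of z "x - y" y] by simp

lemma N_sq: "(N x)\<^sup>2 = p (ip x x)"
  by (simp add: xnorm_def)

lemma N_nonneg: "N x \<ge> 0"
  by (simp add: xnorm_def)

lemma N_xr: "c \<ge> 0 \<Longrightarrow> N (xr c x) = c * N x"
  unfolding xnorm_def ip_smul ip_smul_right by (simp add: p_smul real_sqrt_mult)

text \<open>Expanding the inner square of \<open>y - \<lambda>\<langle>y,x\<rangle>x\<close> with \<open>\<lambda> = 1/\<gamma>\<close> bounds
  \<open>\<lambda>\<langle>y,x\<rangle>\<langle>x,y\<rangle>\<close> by \<open>\<langle>y,y\<rangle>\<close>.\<close>

lemma Cauchy_Schwarz_aux:
  assumes g: "p (ip x x) \<le> \<gamma>" "\<gamma> > 0"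
  shows "(p (ip y x))\<^sup>2 \<le> \<gamma> * p (ip y y)"
proof -
  define a where "a = ip y x"
  define l where "l = 1 / \<gamma>"
  have l: "l > 0" using g by (simp add: l_def)
  define h where "h = rs l (ip x x)"
  have ph: "p h \<le> 1" unfolding h_def p_rs using g l by (simp add: l_def field_simps)
  have hs: "star A h = h" by (simp add: h_def star_smul ip_star)
  have star_cone: "z * star A z \<in> cone" for z using cone_square[of "star A z"] by simp
  \<comment> \<open>Right multiplication by \<open>h\<close> is symmetric for the form
    \<open>u * star A v\<close> since \<open>star A h = h\<close>, and \<open>p h \<le> 1\<close>
    bounds its powers at \<open>a\<close>.\<close>
  have "a * h * star A a \<preceq> a * star A a"
  proof (rule form_contraction[where B = "\<lambda>u v. u * star A v" and S = "\<lambda>u. u * h" and M = "p a * p a"])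
    show "p (((\<lambda>u. u * h) ^^ n) a * star A a) \<le> p a * p a" for n
    proof -
      have "p (((\<lambda>u. u * h) ^^ n) a) \<le> p a"
      proof (induction n)
        case (Suc n)
        have "p (((\<lambda>u. u * h) ^^ n) a * h) \<le> p (((\<lambda>u. u * h) ^^ n) a) * 1"
          by (rule order_trans[OF p_mult mult_left_mono[OF ph p_nonneg]])
        thus ?case using Suc by simp
      qed simp
      thus ?thesis using p_mult[of "((\<lambda>u. u * h) ^^ n) a" "star A a"]
        by (smt (verit) mult_right_mono p_nonneg p_star)
    qed
  qed (simp_all add: algebra_simps star_diff star_mult hs star_cone)
  hence 1: "rs l (a * h * star A a) \<preceq> rs l (a * star A a)" using l by (rule le_rs)
  define z where "z = y - xr l (act X a x)"
  have zz: "ip z z = ip y y - rs l (a * star A a) - rs l (a * star A a) + rs l (a * h * star A a)"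
    unfolding z_def ip_diff ip_diff_right ip_smul ip_smul_right ip_act ip_act_right h_def
    by (simp add: a_def ip_star smul_mult_left smul_mult_right smul_diff smul_add algebra_simps)
  have "rs l (a * star A a) + rs l (a * star A a) \<preceq> ip y y + rs l (a * h * star A a)"
    by (rule le_cone) (use ip_cone[of z] zz in \<open>simp add: algebra_simps\<close>)
  from le_add[OF this 1] have "rs l (a * star A a) \<preceq> ip y y"
    by (rule le_cong) simp
  hence "p (rs l (a * star A a)) \<le> p (ip y y)"
    using l by (intro p_mono cone_rs star_cone) auto
  hence "l * (p a)\<^sup>2 \<le> p (ip y y)" using l by (simp add: p_rs p_mult_star del: of_real_divide)
  thus ?thesis using g unfolding l_def a_def by (simp add: field_simps)
qed

lemma Cauchy_Schwarz: "p (ip x y) \<le> N x * N y"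
proof (rule power2_le_imp_le)
  have "(p (ip x y))\<^sup>2 \<le> p (ip y y) * p (ip x x)"
  proof (rule field_le_epsilon)
    fix \<epsilon> :: real assume e: "\<epsilon> > 0"
    \<comment> \<open>\<open>p (ip y y)\<close> may vanish while \<open>\<gamma>\<close> must be
      positive, so it is enlarged by \<open>d\<close>, which costs at most
      \<open>\<epsilon>\<close>.\<close>
    define d where "d = \<epsilon> / (p (ip x x) + 1)"
    have c: "p (ip x x) + 1 > 0" using p_nonneg[of "ip x x"] by linarith
    have d: "d > 0" using e c by (simp add: d_def)
    have "(p (ip x y))\<^sup>2 \<le> (p (ip y y) + d) * p (ip x x)"
      using d p_nonneg[of "ip y y"] by (intro Cauchy_Schwarz_aux) linarith+
    also have "d * p (ip x x) \<le> d * (p (ip x x) + 1)" using d by simp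
    hence "(p (ip y y) + d) * p (ip x x) \<le> p (ip y y) * p (ip x x) + \<epsilon>"
      using c unfolding d_def by (simp add: distrib_right)
    finally show "(p (ip x y))\<^sup>2 \<le> p (ip y y) * p (ip x x) + \<epsilon>" .
  qed
  thus "(p (ip x y))\<^sup>2 \<le> (N x * N y)\<^sup>2" by (simp add: power_mult_distrib N_sq mult.commute)
qed (simp add: N_nonneg)

lemma N_triangle: "N (x + y) \<le> N x + N y"
proof (rule power2_le_imp_le)
  have "p (ip (x + y) (x + y)) \<le> p (ip x x + ip x y) + p (ip y x + ip y y)"
    unfolding ip_add ip_add_right by (rule order_trans[OF _ p_add]) (simp add: algebra_simps)
  also have "\<dots> \<le> (p (ip x x) + p (ip x y)) + (p (ip y x) + p (ip y y))"
    by (intro add_mono p_add)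
  also have "\<dots> \<le> ((N x)\<^sup>2 + N x * N y) + (N y * N x + (N y)\<^sup>2)"
    by (intro add_mono Cauchy_Schwarz) (simp_all add: N_sq)
  finally show "(N (x + y))\<^sup>2 \<le> (N x + N y)\<^sup>2" by (simp add: N_sq power2_sum algebra_simps)
qed (simp add: N_nonneg)

section \<open>Symmetric contractions and decay of powers\<close>

lemma contraction_le:
  assumes sym: "\<And>x y. ip (S x) y = ip x (S y)" and con: "\<And>x. N (S x) \<le> N x"
  shows "ip (S u) u \<preceq> ip u u"
proof (rule form_contraction[where B = ip and S = S and M = "N u * N u"])
  show "p (ip ((S ^^ n) u) u) \<le> N u * N u" for n
  proof -
    have "N ((S ^^ n) u) \<le> N u"
    proof (induction n)
      case (Suc n)
      thus ?case using con[of "(S ^^ n) u"] by simp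
    qed simp
    hence "N ((S ^^ n) u) * N u \<le> N u * N u" by (intro mult_right_mono N_nonneg)
    thus ?thesis using Cauchy_Schwarz[of "(S ^^ n) u" u] by linarith
  qed
qed (auto simp: ip_diff ip_diff_right sym ip_cone)

text \<open>Cancel \<open>N (T' x)\<close> in
  \<open>(N (T' x))^2 = p (ip (T (T' x)) x) \<le> C * N (T' x) * N x\<close>.\<close>

lemma adjoint_bound:
  assumes adj: "\<And>x y. ip (T x) y = ip x (T' y)" and con: "\<And>x. N (T x) \<le> C * N x"
  shows "N (T' x) \<le> C * N x"
proof (cases "N (T' x) = 0")
  case True
  have "0 \<le> C * N x" using con[of x] N_nonneg[of "T x"] by linarith
  thus ?thesis using True by simp
next
  case False
  have "N (T' x) * N (T' x) = p (ip (T (T' x)) x)" using N_sq[of "T' x"] adj[of "T' x" x] by (simp add: power2_eq_square)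
  also have "\<dots> \<le> N (T (T' x)) * N x" by (rule Cauchy_Schwarz)
  also have "\<dots> \<le> (C * N (T' x)) * N x" by (intro mult_right_mono con N_nonneg)
  finally have "N (T' x) * N (T' x) \<le> N (T' x) * (C * N x)" by (simp add: mult_ac)
  thus ?thesis using False N_nonneg[of "T' x"] by simp
qed

text \<open>For \<open>W = 1 - TT'\<close> the operators \<open>TT' W\<^sup>2\<^sup>k\<close> decrease in \<open>k\<close> and their sums
  telescope below the identity.\<close>

lemma power_decay:
  assumes adj: "\<And>x y. ip (T x) y = ip x (T' y)" and con: "\<And>x. N (T x) \<le> N x"
  defines "W \<equiv> \<lambda>x. x - T (T' x)"
  shows "real n * (N (T' ((W ^^ n) u)))\<^sup>2 \<le> (N u)\<^sup>2"
proof -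
  define S where "S = (\<lambda>x. T (T' x))"
  have adj': "ip x (T y) = ip (T' x) y" for x y by (metis adj ip_star)
  have con': "N (T' x) \<le> N x" for x using adjoint_bound[of T T' 1] adj con by simp
  have S: "ip (S x) y = ip x (S y)" for x y unfolding S_def by (simp add: adj adj')
  have Scon: "N (S x) \<le> N x" for x unfolding S_def using con[of "T' x"] con'[of x] by linarith
  have W: "W x = x - S x" for x unfolding W_def S_def ..
  define E where "E x = ip (T' x) (T' x)" for x
  have E: "E x = ip (S x) x" for x unfolding E_def S_def by (simp add: adj)
  have E_cone: "E x \<in> cone" for x unfolding E_def by (rule ip_cone)
  \<comment> \<open>In operator form \<open>S - WSW = S^2 + S(1 - S)S\<close> for
    \<open>W = 1 - S\<close>, and both terms are positive.\<close>
  have dec: "E (W x) \<preceq> E x" for x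
  proof -
    have "ip (S (W x)) (W x) = ip (S x) x - ip (S x) (S x) - ip (S x) (S x) + ip (S (S x)) (S x)"
    proof -
      have "ip (S (W x)) (W x) = ip x (S (W x)) - ip (S x) (S (W x))" by (simp add: S W[of x] ip_diff)
      also have "\<dots> = ip (S x) (W x) - ip (S (S x)) (W x)" by (simp add: S)
      also have "\<dots> = ip (S x) x - ip (S x) (S x) - (ip (S (S x)) x - ip (S (S x)) (S x))"
        unfolding W ip_diff_right ..
      also have "ip (S (S x)) x = ip (S x) (S x)" by (rule S)
      finally show ?thesis by (simp add: algebra_simps)
    qed
    hence eq: "E x - E (W x) = ip (S x) (S x) + (ip (S x) (S x) - ip (S (S x)) (S x))"
      unfolding E by (simp add: algebra_simps)
    have "0 \<preceq> ip (S x) (S x)" by (rule le_cone) (simp add: ip_cone)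
    from le_add[OF this contraction_le[OF S Scon, of "S x"]]
    have "ip (S (S x)) (S x) \<preceq> ip (S x) (S x) + ip (S x) (S x)" by simp
    thus ?thesis by (rule le_cong) (simp add: eq)
  qed
  \<comment> \<open>Here \<open>1 - S - W^2 = S - S^2 = T(1 - T'T)T'\<close>, which is positive
    because \<open>T'T\<close> is a symmetric contraction.\<close>
  have tel: "E x + ip (W x) (W x) \<preceq> ip x x" for x
  proof -
    have TT: "ip (T' (T a)) b = ip a (T' (T b))" for a b by (simp add: adj flip: adj')
    have "ip (T' (T (T' x))) (T' x) \<preceq> ip (T' x) (T' x)"
      using contraction_le[of "\<lambda>y. T' (T y)", OF TT] con con' by (meson order_trans)
    hence "ip (S x) (S x) \<preceq> E x" unfolding S_def E_def by (simp flip: adj')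
    moreover have "ip x x - (E x + ip (W x) (W x)) = E x - ip (S x) (S x)"
      unfolding W E ip_diff ip_diff_right using S[of x x] by (simp add: algebra_simps)
    ultimately show ?thesis by (rule le_cong[OF _ sym])
  qed
  have "rs (real n) (E ((W ^^ n) u)) + ip ((W ^^ n) u) ((W ^^ n) u) \<preceq> ip u u"
  proof (induction n)
    case 0
    show ?case by (simp add: le_refl)
  next
    case (Suc n)
    define v where "v = (W ^^ n) u"
    have rsE: "rs (real (Suc n)) y = rs (real n) y + y" for y
      using smul_add_left[of "complex_of_real (real n)" 1 y] by (simp add: add.commute)
    \<comment> \<open>All \<open>n + 1\<close> copies of \<open>E (W v)\<close> are raised to
      \<open>E v\<close>; one of them is absorbed with \<open>ip (W v) (W v)\<close> into
      \<open>ip v v\<close>, and the other \<open>n\<close> are left for the induction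
      hypothesis.\<close>
    have "rs (real (Suc n)) (E (W v)) \<preceq> rs (real (Suc n)) (E v)" by (rule le_rs[OF dec]) simp
    from le_add[OF this le_refl[of "ip (W v) (W v)"]]
    have "rs (real (Suc n)) (E (W v)) + ip (W v) (W v) \<preceq> rs (real n) (E v) + (E v + ip (W v) (W v))"
      unfolding rsE by (simp add: add.assoc)
    also have "rs (real n) (E v) + (E v + ip (W v) (W v)) \<preceq> rs (real n) (E v) + ip v v"
      by (rule le_add[OF le_refl tel])
    finally (le_trans) have "rs (real (Suc n)) (E (W v)) + ip (W v) (W v) \<preceq> rs (real n) (E v) + ip v v" .
    from le_trans[OF this] Suc show ?case unfolding v_def by simp
  qed
  moreover have "rs (real n) (E ((W ^^ n) u)) \<preceq> rs (real n) (E ((W ^^ n) u)) + ip ((W ^^ n) u) ((W ^^ n) u)"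
    by (rule le_cone) (simp add: ip_cone)
  ultimately have "rs (real n) (E ((W ^^ n) u)) \<preceq> ip u u" using le_trans by blast
  hence "p (rs (real n) (E ((W ^^ n) u))) \<le> p (ip u u)"
    by (intro p_mono cone_rs E_cone) simp
  thus ?thesis by (simp add: p_rs N_sq E_def del: of_real_of_nat_eq)
qed

text \<open>Let \<open>v = W^n K u\<close> and \<open>w = W^n v\<close>. Symmetry of
  \<open>W\<close> gives \<open>(N v)^2 = p (ip u (K' w)) \<le> N u * N (K' w)\<close>, while
  \<open>dom\<close> and \<open>power_decay\<close> bound \<open>n * (N (K' w))^2\<close> by a
  multiple of \<open>(N v)^2\<close>. Cancelling \<open>(N v)^2\<close> leaves decay of order
  \<open>1/n\<close>.\<close>

lemma range_approx:
  assumes T: "\<And>x y. ip (T x) y = ip x (T' y)" and con: "\<And>x. N (T x) \<le> N x"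
    and K: "\<And>x y. ip (K x) y = ip x (K' y)"
    and dom: "\<And>x. (N (K' x))\<^sup>2 \<le> c * (N (T' x))\<^sup>2"
    and e: "\<epsilon> > 0"
  shows "\<exists>n. N (((\<lambda>x. x - T (T' x)) ^^ n) (K u)) < \<epsilon>"
proof -
  define W where "W = (\<lambda>x. x - T (T' x))"
  have T': "ip x (T y) = ip (T' x) y" for x y by (metis T ip_star)
  have W: "ip (W x) y = ip x (W y)" for x y
    unfolding W_def by (simp add: ip_diff ip_diff_right T T')
  have Wn: "ip ((W ^^ n) x) y = ip x ((W ^^ n) y)" for n x y
    by (induction n arbitrary: x y) (simp_all add: W funpow_swap1)
  have bound: "real n * (N ((W ^^ n) (K u)))\<^sup>2 \<le> \<bar>c\<bar> * (N u)\<^sup>2" for n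
  proof -
    define v where "v = (W ^^ n) (K u)"
    define w where "w = (W ^^ n) v"
    have "(N v)\<^sup>2 = p (ip (K u) w)" unfolding N_sq by (simp add: v_def w_def Wn)
    also have "\<dots> = p (ip u (K' w))" by (simp add: K)
    also have "\<dots> \<le> N u * N (K' w)" by (rule Cauchy_Schwarz)
    finally have "((N v)\<^sup>2)\<^sup>2 \<le> (N u * N (K' w))\<^sup>2" by (intro power_mono) auto
    also have "\<dots> \<le> (N u)\<^sup>2 * (\<bar>c\<bar> * (N (T' w))\<^sup>2)"
      unfolding power_mult_distrib
      using order_trans[OF dom mult_right_mono[OF abs_ge_self]] by (intro mult_left_mono) auto
    finally have "real n * ((N v)\<^sup>2)\<^sup>2 \<le> real n * ((N u)\<^sup>2 * (\<bar>c\<bar> * (N (T' w))\<^sup>2))"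
      by (intro mult_left_mono) auto
    also have "\<dots> = (\<bar>c\<bar> * (N u)\<^sup>2) * (real n * (N (T' w))\<^sup>2)" by (simp add: mult_ac)
    also have "\<dots> \<le> (\<bar>c\<bar> * (N u)\<^sup>2) * (N v)\<^sup>2"
      unfolding w_def W_def by (intro mult_left_mono power_decay[OF T con]) auto
    finally have le: "(real n * (N v)\<^sup>2) * (N v)\<^sup>2 \<le> (\<bar>c\<bar> * (N u)\<^sup>2) * (N v)\<^sup>2"
      by (simp add: power2_eq_square mult_ac)
    show ?thesis
    proof (cases "N v = 0")
      case False
      hence "(N v)\<^sup>2 > 0" by simp
      thus ?thesis using le unfolding v_def[symmetric] by (simp only: mult_le_cancel_right_pos)
    qed (simp add: v_def)
  qed
  obtain n where n: "real n > \<bar>c\<bar> * (N u)\<^sup>2 / \<epsilon>\<^sup>2" using reals_Archimedean2 by blast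
  have "0 \<le> \<bar>c\<bar> * (N u)\<^sup>2 / \<epsilon>\<^sup>2" by simp
  hence n0: "real n > 0" using n by linarith
  have "real n * (N ((W ^^ n) (K u)))\<^sup>2 < real n * \<epsilon>\<^sup>2"
    using bound[of n] n e by (simp add: field_simps)
  hence "(N ((W ^^ n) (K u)))\<^sup>2 < \<epsilon>\<^sup>2" using n0 by (simp only: mult_less_cancel_left_pos)
  hence "N ((W ^^ n) (K u)) < \<epsilon>" by (rule power2_less_imp_less) (use e in simp)
  thus ?thesis unfolding W_def by blast
qed

end

section \<open>From the frame inequalities to surjectivity\<close>

lemma is_adjoint_adjoint:
  assumes "T \<in> Hom_star A X" shows "is_adjoint X T (adjoint X T)"
proof -
  have "\<exists>T'. is_adjoint X T T'" using assms unfolding Hom_star_def by blast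
  thus ?thesis unfolding adjoint_def by (rule someI_ex)
qed

theorem theorem4p10:
  fixes A :: "('a::ring) procstar"
    and X :: "('a, 'x::ab_group_add) hmodule"
    and K T :: "'x \<Rightarrow> 'x"
    and \<xi>s :: "'i \<Rightarrow> 'x"
    and I :: "'i set"
  assumes "hilbert_module A X"
    and "K \<in> Hom_star A X" and "uniformly_bounded A X K" and "dense_in_X A X (range K)"
    and "K_frame A X K \<xi>s I"
    and "T \<in> Hom_star A X" and "uniformly_bounded A X T" and "closed_in_X A X (range T)"
    and "K_frame A X K (\<lambda>i. T (\<xi>s i)) I"
  shows "surj T"
proof -
  define K' where "K' = adjoint X K"
  define T' where "T' = adjoint X T"
  have K: "inner X (K x) y = inner X x (K' y)" for x y
    using is_adjoint_adjoint[OF assms(2)] unfolding K'_def is_adjoint_def by blast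
  have T: "inner X (T x) y = inner X x (T' y)" for x y
    using is_adjoint_adjoint[OF assms(6)] unfolding T'_def is_adjoint_def by blast
  have T_add: "T (x + y) = T x + T y" and T_smul: "T (xsmul X c x) = xsmul X c (T x)" for x y c
    using assms(6) unfolding Hom_star_def by blast+
  obtain C where C: "C > 0" "\<And>p x. p \<in> seminorms A \<Longrightarrow> xnorm X p (T x) \<le> C * xnorm X p x"
    using assms(7) unfolding uniformly_bounded_def by blast
  obtain a where a: "a > 0" and lower: "\<And>x s. has_sumA A (\<lambda>i. inner X x (T (\<xi>s i)) * inner X (T (\<xi>s i)) x) I s \<Longrightarrow>
      leA A (smul A (complex_of_real a) (inner X (K' x) (K' x))) s"
    and summ: "\<And>x. \<exists>s. has_sumA A (\<lambda>i. inner X x (T (\<xi>s i)) * inner X (T (\<xi>s i)) x) I s"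
    using assms(9) unfolding K_frame_def K'_def by blast
  obtain b where b: "b > 0" and upper: "\<And>x s. has_sumA A (\<lambda>i. inner X x (\<xi>s i) * inner X (\<xi>s i) x) I s \<Longrightarrow>
      leA A s (smul A (complex_of_real b) (inner X x x))"
    using assms(5) unfolding K_frame_def by blast
  \<comment> \<open>As the range of \<open>T\<close> is closed, density suffices, and the closure
    condition can be checked for one \<open>p\<close> at a time.\<close>
  have "x \<in> xclosure A X (range T)" for x
    unfolding xclosure_def
  proof (intro CollectI ballI allI impI)
    fix p and \<epsilon> :: real assume p: "p \<in> seminorms A" and e: "\<epsilon> > 0"
    have A: "pro_cstar_algebra A" using assms(1) unfolding hilbert_module_def by blast
    interpret seminormed_hmodule A p X using A p assms(1) by unfold_locales
    have T': "ip x (T y) = ip (T' x) y" for x y by (metis T ip_star)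
    have dom: "(N (K' y))\<^sup>2 \<le> b / a * (N (T' y))\<^sup>2" for y
    proof -
      obtain s where s: "has_sumA A (\<lambda>i. ip y (T (\<xi>s i)) * ip (T (\<xi>s i)) y) I s" using summ by blast
      \<comment> \<open>The frame sum of the vectors \<open>T (\<xi>s i)\<close> at \<open>y\<close>
        is that of the \<open>\<xi>s i\<close> at \<open>T' y\<close>, so the lower bound of one
        frame and the upper bound of the other meet in the same \<open>s\<close>.\<close>
      hence "has_sumA A (\<lambda>i. ip (T' y) (\<xi>s i) * ip (\<xi>s i) (T' y)) I s" by (simp add: T T')
      from upper[OF this] lower[OF s]
      have "le (rs a (ip (K' y) (K' y))) s" "le s (rs b (ip (T' y) (T' y)))"
        unfolding leA_def by (auto intro: le_cone positive_cone)
      hence "le (rs a (ip (K' y) (K' y))) (rs b (ip (T' y) (T' y)))" by (rule le_trans)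
      hence "p (rs a (ip (K' y) (K' y))) \<le> p (rs b (ip (T' y) (T' y)))"
        using a by (intro p_mono cone_rs ip_cone) simp
      hence "a * (N (K' y))\<^sup>2 \<le> b * (N (T' y))\<^sup>2" using a b by (simp add: p_rs N_sq)
      thus ?thesis using a by (simp add: field_simps)
    qed
    \<comment> \<open>Rescaling makes \<open>T\<close> a contraction and keeps its values in the
      range of \<open>T\<close>; the domination constant picks up a factor
      \<open>C^2\<close>.\<close>
    define T1 where "T1 y = xr (1 / C) (T y)" for y
    define T1' where "T1' y = xr (1 / C) (T' y)" for y
    have T1: "ip (T1 y) z = ip y (T1' z)" for y z
      unfolding T1_def T1'_def by (simp add: ip_smul ip_smul_right T)
    have con: "N (T1 y) \<le> N y" for y
    proof -
      have "N (T1 y) = N (T y) / C" unfolding T1_def using N_xr[of "1 / C" "T y"] C(1) by simp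
      also have "\<dots> \<le> N y" using C(2)[OF p, of y] C(1) by (simp add: pos_divide_le_eq mult.commute)
      finally show ?thesis .
    qed
    have dom1: "(N (K' y))\<^sup>2 \<le> (b / a * C\<^sup>2) * (N (T1' y))\<^sup>2" for y
      unfolding T1'_def using dom[of y] C(1) N_xr[of "1 / C" "T' y"] by (simp add: power_divide)
    define W where "W = (\<lambda>y. y - T1 (T1' y))"
    have "x \<in> xclosure A X (range K)" using assms(4) unfolding dense_in_X_def by simp
    hence "\<exists>\<eta>\<in>range K. N (x - \<eta>) < \<epsilon> / 2" using p half_gt_zero[OF e] unfolding xclosure_def by blast
    then obtain u where u: "N (x - K u) < \<epsilon> / 2" by blast
    obtain n where n: "N ((W ^^ n) (K u)) < \<epsilon> / 2"
      using range_approx[of T1 T1' K K', OF T1 con K dom1, of "\<epsilon> / 2" u] e unfolding W_def by auto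
    \<comment> \<open>Each application of \<open>W\<close> subtracts an element of the range of
      \<open>T\<close>.\<close>
    have "\<exists>v. y - (W ^^ m) y = T v" for y m
    proof (induction m)
      case 0
      show ?case using T_add[of 0 0] by (intro exI[of _ 0]) simp
    next
      case (Suc m)
      then obtain v where "y - (W ^^ m) y = T v" by blast
      moreover have "T1 z = T (xr (1 / C) z)" for z by (simp add: T1_def T_smul)
      ultimately have "y - (W ^^ Suc m) y = T (v + xr (1 / C) (T1' ((W ^^ m) y)))"
        by (simp add: W_def T_add algebra_simps)
      thus ?case by blast
    qed
    then obtain v where "K u - (W ^^ n) (K u) = T v" by blast
    hence "x - T v = (x - K u) + (W ^^ n) (K u)" by (simp add: algebra_simps)
    hence "N (x - T v) \<le> N (x - K u) + N ((W ^^ n) (K u))" by (simp only: N_triangle)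
    also have "\<dots> < \<epsilon> / 2 + \<epsilon> / 2" by (rule add_strict_mono[OF u n])
    finally have "N (x - T v) < \<epsilon>" by simp
    thus "\<exists>\<eta>\<in>range T. N (x - \<eta>) < \<epsilon>" by blast
  qed
  thus ?thesis using assms(8) unfolding closed_in_X_def by blast
qed

end
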